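(* Let $T$ be a nice t-minimal theory, $\mathbb{M}$ a monster model, $G,H$ definable groups, and $f:G\to H$ a definable homomorphism. Then $f$ is continuous with respect to the canonical topologies on $G$ and $H$.
   Context: A complete one-sorted theory $T$ is t-minimal if there is a Hausdorff topology on models $M$ of $T$ (on $M^1$) with a basis given by a definable family, such that every definable $D\subseteq M$ has non-empty interior iff $D$ is infinite. "Definable" means definable with parameters; $\mathbb{M}^n$ has the product topology. $\dim(X)$ for definable $X\subseteq\mathbb{M}^n$ is $-\infty$ if $X=\emptyset$ and otherwise the largest $k$ such that some coordinate projection of $X$ to $\mathbb{M}^k$ has non-empty interior. A $k$-correspondence $f:X\rightrightarrows Y$ assigns a $k$-element subset of $Y$ to each $x\in X$; it is continuous if locally $f(x)=\{g_1(x),\dots,g_k(x)\}$ with continuous $g_i$. $T$ is nice if every definable $k$-correspondence $f:U\rightrightarrows\mathbb{M}^m$ on a definable open $U\subseteq\mathbb{M}^n$ is continuous on a definable open $U_0\subseteq U$ with $\dim(U\setminus U_0)<n$. A cell is $\sigma(\Gamma(f))$ for $f:U\rightrightarrows\mathbb{M}^{n-i}$ a continuous definable correspondence on a definable open $U\subseteq\mathbb{M}^i$ and $\sigma$ a coordinate permutation. A definable manifold is a definable set with a topology having a definable basis, covered by finitely many definable open subsets each definably homeomorphic to an open subset of a cell. The canonical topology on a definable group $G$ is the unique definable topology making $G$ a definable manifold and a topological group. *)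

theory Defs
  imports "HOL-Analysis.Analysis" "HOL-Algebra.Group"
begin

unbundle cardinal_syntax

section \<open>One-sorted first-order logic\<close>

text \<open>A language is a set of symbols tagged with their arities; constants are the 0-ary function
  symbols.\<close>

record ('f, 'r) fo_lang =
  Funs :: "('f \<times> nat) set"
  Rels :: "('r \<times> nat) set"

datatype 'f trm = Var nat | App 'f "'f trm list"

datatype ('f, 'r) fm =
    Eq "'f trm" "'f trm"
  | Rel 'r "'f trm list"
  | Neg "('f, 'r) fm"
  | Conj "('f, 'r) fm" "('f, 'r) fm"
  | Exi nat "('f, 'r) fm"

primrec wf_trm :: "('f, 'r) fo_lang \<Rightarrow> 'f trm \<Rightarrow> bool" where
  "wf_trm L (Var i) \<longleftrightarrow> True"
| "wf_trm L (App f ts) \<longleftrightarrow> (f, length ts) \<in> Funs L \<and> list_all (wf_trm L) ts"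

primrec wf_fm :: "('f, 'r) fo_lang \<Rightarrow> ('f, 'r) fm \<Rightarrow> bool" where
  "wf_fm L (Eq s t) \<longleftrightarrow> wf_trm L s \<and> wf_trm L t"
| "wf_fm L (Rel r ts) \<longleftrightarrow> (r, length ts) \<in> Rels L \<and> (\<forall>t\<in>set ts. wf_trm L t)"
| "wf_fm L (Neg \<phi>) \<longleftrightarrow> wf_fm L \<phi>"
| "wf_fm L (Conj \<phi> \<psi>) \<longleftrightarrow> wf_fm L \<phi> \<and> wf_fm L \<psi>"
| "wf_fm L (Exi i \<phi>) \<longleftrightarrow> wf_fm L \<phi>"

primrec fv_trm :: "'f trm \<Rightarrow> nat set" where
  "fv_trm (Var i) = {i}"
| "fv_trm (App f ts) = \<Union>(set (map fv_trm ts))"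

primrec fv :: "('f, 'r) fm \<Rightarrow> nat set" where
  "fv (Eq s t) = fv_trm s \<union> fv_trm t"
| "fv (Rel r ts) = (\<Union>t\<in>set ts. fv_trm t)"
| "fv (Neg \<phi>) = fv \<phi>"
| "fv (Conj \<phi> \<psi>) = fv \<phi> \<union> fv \<psi>"
| "fv (Exi i \<phi>) = fv \<phi> - {i}"

definition sentence :: "('f, 'r) fo_lang \<Rightarrow> ('f, 'r) fm \<Rightarrow> bool" where
  "sentence L \<phi> \<longleftrightarrow> wf_fm L \<phi> \<and> fv \<phi> = {}"

record ('f, 'r, 'a) fo_struct =
  univ :: "'a set"
  fint :: "'f \<Rightarrow> 'a list \<Rightarrow> 'a"
  rint :: "'r \<Rightarrow> 'a list \<Rightarrow> bool"

definition fo_structure :: "('f, 'r) fo_lang \<Rightarrow> ('f, 'r, 'a) fo_struct \<Rightarrow> bool" where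
  "fo_structure L M \<longleftrightarrow> univ M \<noteq> {} \<and>
     (\<forall>(f, n)\<in>Funs L. \<forall>as. length as = n \<and> set as \<subseteq> univ M \<longrightarrow> fint M f as \<in> univ M)"

primrec eval_trm :: "('f, 'r, 'a) fo_struct \<Rightarrow> (nat \<Rightarrow> 'a) \<Rightarrow> 'f trm \<Rightarrow> 'a" where
  "eval_trm M e (Var i) = e i"
| "eval_trm M e (App f ts) = fint M f (map (eval_trm M e) ts)"

primrec sat :: "('f, 'r, 'a) fo_struct \<Rightarrow> (nat \<Rightarrow> 'a) \<Rightarrow> ('f, 'r) fm \<Rightarrow> bool" where
  "sat M e (Eq s t) \<longleftrightarrow> eval_trm M e s = eval_trm M e t"
| "sat M e (Rel r ts) \<longleftrightarrow> rint M r (map (eval_trm M e) ts)"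
| "sat M e (Neg \<phi>) \<longleftrightarrow> \<not> sat M e \<phi>"
| "sat M e (Conj \<phi> \<psi>) \<longleftrightarrow> sat M e \<phi> \<and> sat M e \<psi>"
| "sat M e (Exi i \<phi>) \<longleftrightarrow> (\<exists>a\<in>univ M. sat M (e(i := a)) \<phi>)"

definition holds :: "('f, 'r, 'a) fo_struct \<Rightarrow> ('f, 'r) fm \<Rightarrow> bool" where
  "holds M \<phi> \<longleftrightarrow> (\<forall>e. range e \<subseteq> univ M \<longrightarrow> sat M e \<phi>)"

definition is_model :: "('f, 'r) fo_lang \<Rightarrow> ('f, 'r) fm set \<Rightarrow> ('f, 'r, 'a) fo_struct \<Rightarrow> bool" where
  "is_model L T M \<longleftrightarrow> fo_structure L M \<and> (\<forall>\<phi>\<in>T. holds M \<phi>)"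

text \<open>HOL cannot quantify over models in all types at once, so a property of a theory refers to the
  models with universe in a given type \<open>'a\<close>. When \<open>'a\<close> has a subset carrying a monster model, this
  covers, up to isomorphism, all models of at most that cardinality; in particular completeness
  then agrees with the usual notion, by the downward Loewenheim--Skolem theorem.\<close>

definition complete_theory :: "'a itself \<Rightarrow> ('f, 'r) fo_lang \<Rightarrow> ('f, 'r) fm set \<Rightarrow> bool" where
  "complete_theory _ L T \<longleftrightarrow> (\<forall>\<phi>\<in>T. sentence L \<phi>) \<and>
     (\<exists>M :: ('f, 'r, 'a) fo_struct. is_model L T M) \<and>
     (\<forall>\<phi>. sentence L \<phi> \<longrightarrow>
        (\<forall>M :: ('f, 'r, 'a) fo_struct. is_model L T M \<longrightarrow> holds M \<phi>) \<or>
        (\<forall>M :: ('f, 'r, 'a) fo_struct. is_model L T M \<longrightarrow> holds M (Neg \<phi>)))"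


section \<open>Monster models\<close>

text \<open>A type in the variable 0 over \<open>A\<close> is a set of pairs \<open>(\<phi>, c)\<close>, where the assignment \<open>c\<close> supplies
  parameters from \<open>A\<close> for the other free variables of \<open>\<phi>\<close>.\<close>

definition saturated ::
  "('f, 'r) fo_lang \<Rightarrow> 'k rel \<Rightarrow> ('f, 'r, 'a) fo_struct \<Rightarrow> bool" where
  "saturated L \<kappa> M \<longleftrightarrow>
     (\<forall>A \<Sigma>. A \<subseteq> univ M \<and> |A| <o \<kappa> \<and>
        (\<forall>(\<phi>, c)\<in>\<Sigma>. wf_fm L \<phi> \<and> (\<forall>i\<in>fv \<phi> - {0}. c i \<in> A)) \<and>
        (\<forall>\<Sigma>0. finite \<Sigma>0 \<and> \<Sigma>0 \<subseteq> \<Sigma> \<longrightarrow> (\<exists>a\<in>univ M. \<forall>(\<phi>, c)\<in>\<Sigma>0. sat M (c(0 := a)) \<phi>))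
        \<longrightarrow> (\<exists>a\<in>univ M. \<forall>(\<phi>, c)\<in>\<Sigma>. sat M (c(0 := a)) \<phi>))"

definition partial_elementary ::
  "('f, 'r) fo_lang \<Rightarrow> ('f, 'r, 'a) fo_struct \<Rightarrow> 'a set \<Rightarrow> ('a \<Rightarrow> 'a) \<Rightarrow> bool" where
  "partial_elementary L M A h \<longleftrightarrow> A \<subseteq> univ M \<and> h ` A \<subseteq> univ M \<and>
     (\<forall>\<phi> c. wf_fm L \<phi> \<and> (\<forall>i\<in>fv \<phi>. c i \<in> A) \<longrightarrow> (sat M (h \<circ> c) \<phi> \<longleftrightarrow> sat M c \<phi>))"

definition automorphism ::
  "('f, 'r) fo_lang \<Rightarrow> ('f, 'r, 'a) fo_struct \<Rightarrow> ('a \<Rightarrow> 'a) \<Rightarrow> bool" where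
  "automorphism L M g \<longleftrightarrow> bij_betw g (univ M) (univ M) \<and>
     (\<forall>(f, n)\<in>Funs L. \<forall>as. length as = n \<and> set as \<subseteq> univ M
        \<longrightarrow> g (fint M f as) = fint M f (map g as)) \<and>
     (\<forall>(r, n)\<in>Rels L. \<forall>as. length as = n \<and> set as \<subseteq> univ M
        \<longrightarrow> rint M r (map g as) = rint M r as)"

definition strongly_homogeneous ::
  "('f, 'r) fo_lang \<Rightarrow> 'k rel \<Rightarrow> ('f, 'r, 'a) fo_struct \<Rightarrow> bool" where
  "strongly_homogeneous L \<kappa> M \<longleftrightarrow>
     (\<forall>A h. |A| <o \<kappa> \<and> partial_elementary L M A h
        \<longrightarrow> (\<exists>g. automorphism L M g \<and> (\<forall>a\<in>A. g a = h a)))"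

text \<open>There are \<open>|L| + \<aleph>\<^sub>0\<close> many \<open>L\<close>-formulas, so \<open>\<kappa> > |L| + \<aleph>\<^sub>0\<close>. Taking \<open>\<kappa>\<close> on the type \<open>'a\<close> is no
  loss, since an infinite \<open>\<kappa>\<close>-saturated structure has cardinality at least \<open>\<kappa>\<close>.\<close>

definition monster_model ::
  "('f, 'r) fo_lang \<Rightarrow> ('f, 'r) fm set \<Rightarrow> ('f, 'r, 'a) fo_struct \<Rightarrow> bool" where
  "monster_model L T M \<longleftrightarrow> is_model L T M \<and>
     (\<exists>\<kappa> :: 'a rel. Card_order \<kappa> \<and> |{\<phi> :: ('f, 'r) fm. wf_fm L \<phi>}| <o \<kappa> \<and>
        saturated L \<kappa> M \<and> strongly_homogeneous L \<kappa> M)"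


section \<open>Definable sets, with parameters\<close>

text \<open>\<open>M\<^sup>n\<close> consists of the extensional functions on \<open>{..<n}\<close>, as for \<^const>\<open>product_topology\<close>.\<close>

definition tuples :: "('f, 'r, 'a) fo_struct \<Rightarrow> nat \<Rightarrow> (nat \<Rightarrow> 'a) set" where
  "tuples M n = ({..<n} \<rightarrow>\<^sub>E univ M)"

definition join :: "nat \<Rightarrow> nat \<Rightarrow> (nat \<Rightarrow> 'a) \<Rightarrow> (nat \<Rightarrow> 'a) \<Rightarrow> (nat \<Rightarrow> 'a)" where
  "join n m x y = (\<lambda>i\<in>{..<n + m}. if i < n then x i else y (i - n))"

definition singleton_tuple :: "'a \<Rightarrow> (nat \<Rightarrow> 'a)" where
  "singleton_tuple a = (\<lambda>i\<in>{..<1}. a)"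

text \<open>The variables \<open>0, \<dots>, n - 1\<close> range over the tuple; the assignment \<open>c\<close> gives the values of the
  remaining variables of \<open>\<phi>\<close>, that is, the parameters.\<close>

definition definable ::
  "('f, 'r) fo_lang \<Rightarrow> ('f, 'r, 'a) fo_struct \<Rightarrow> nat \<Rightarrow> (nat \<Rightarrow> 'a) set \<Rightarrow> bool" where
  "definable L M n X \<longleftrightarrow>
     (\<exists>\<phi> c. wf_fm L \<phi> \<and> range c \<subseteq> univ M \<and>
        X = {x \<in> tuples M n. sat M (override_on c x {..<n}) \<phi>})"

definition definable1 :: "('f, 'r) fo_lang \<Rightarrow> ('f, 'r, 'a) fo_struct \<Rightarrow> 'a set \<Rightarrow> bool" where
  "definable1 L M D \<longleftrightarrow> definable L M 1 (singleton_tuple ` D)"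

definition definable_family ::
  "('f, 'r) fo_lang \<Rightarrow> ('f, 'r, 'a) fo_struct \<Rightarrow> nat \<Rightarrow> (nat \<Rightarrow> 'a) set set \<Rightarrow> bool" where
  "definable_family L M n \<F> \<longleftrightarrow>
     (\<exists>k Y D. definable L M k Y \<and> definable L M (k + n) D \<and>
        \<F> = (\<lambda>b. {x \<in> tuples M n. join k n b x \<in> D}) ` Y)"

definition definable_map ::
  "('f, 'r) fo_lang \<Rightarrow> ('f, 'r, 'a) fo_struct \<Rightarrow> nat \<Rightarrow> nat \<Rightarrow> (nat \<Rightarrow> 'a) set
     \<Rightarrow> ((nat \<Rightarrow> 'a) \<Rightarrow> (nat \<Rightarrow> 'a)) \<Rightarrow> bool" where
  "definable_map L M n m X f \<longleftrightarrow> definable L M (n + m) ((\<lambda>x. join n m x (f x)) ` X)"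

definition is_base :: "'b topology \<Rightarrow> 'b set set \<Rightarrow> bool" where
  "is_base \<tau> \<B> \<longleftrightarrow> openin \<tau> = arbitrary union_of (\<lambda>W. W \<in> \<B>)"


section \<open>T-minimality, dimension and correspondences\<close>

definition t_minimal_topology ::
  "('f, 'r) fo_lang \<Rightarrow> ('f, 'r, 'a) fo_struct \<Rightarrow> 'a topology \<Rightarrow> bool" where
  "t_minimal_topology L M \<tau> \<longleftrightarrow> topspace \<tau> = univ M \<and> Hausdorff_space \<tau> \<and>
     (\<exists>\<B>. is_base \<tau> \<B> \<and> definable_family L M 1 ((`) singleton_tuple ` \<B>)) \<and>
     (\<forall>D. D \<subseteq> univ M \<and> definable1 L M D \<longrightarrow> (\<tau> interior_of D \<noteq> {} \<longleftrightarrow> infinite D))"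

definition t_minimal :: "'a itself \<Rightarrow> ('f, 'r) fo_lang \<Rightarrow> ('f, 'r) fm set \<Rightarrow> bool" where
  "t_minimal TA L T \<longleftrightarrow> complete_theory TA L T \<and>
     (\<forall>M :: ('f, 'r, 'a) fo_struct. is_model L T M \<longrightarrow> (\<exists>\<tau>. t_minimal_topology L M \<tau>))"

definition power_topology :: "'a topology \<Rightarrow> nat \<Rightarrow> (nat \<Rightarrow> 'a) topology" where
  "power_topology \<tau> n = product_topology (\<lambda>_. \<tau>) {..<n}"

definition coord_proj :: "nat \<Rightarrow> (nat \<Rightarrow> nat) \<Rightarrow> (nat \<Rightarrow> 'a) \<Rightarrow> (nat \<Rightarrow> 'a)" where
  "coord_proj k \<sigma> x = (\<lambda>j\<in>{..<k}. x (\<sigma> j))"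

text \<open>For nonempty \<open>X\<close> the maximum is over a nonempty set, since the projection to the one-point
  space \<open>M\<^sup>0\<close> is onto.\<close>

definition dimension :: "'a topology \<Rightarrow> nat \<Rightarrow> (nat \<Rightarrow> 'a) set \<Rightarrow> ereal" where
  "dimension \<tau> n X =
     (if X = {} then -\<infinity>
      else ereal (real (Max {k. \<exists>\<sigma>. strict_mono_on {..<k} \<sigma> \<and> \<sigma> ` {..<k} \<subseteq> {..<n} \<and>
                               power_topology \<tau> k interior_of (coord_proj k \<sigma> ` X) \<noteq> {}})))"

definition correspondence :: "nat \<Rightarrow> 'b set \<Rightarrow> 'c set \<Rightarrow> ('b \<Rightarrow> 'c set) \<Rightarrow> bool" where
  "correspondence k X Y f \<longleftrightarrow> (\<forall>x\<in>X. f x \<subseteq> Y \<and> finite (f x) \<and> card (f x) = k)"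

definition corr_graph ::
  "nat \<Rightarrow> nat \<Rightarrow> (nat \<Rightarrow> 'a) set \<Rightarrow> ((nat \<Rightarrow> 'a) \<Rightarrow> (nat \<Rightarrow> 'a) set) \<Rightarrow> (nat \<Rightarrow> 'a) set" where
  "corr_graph n m U f = {join n m x y | x y. x \<in> U \<and> y \<in> f x}"

definition continuous_corr ::
  "'b topology \<Rightarrow> 'c topology \<Rightarrow> nat \<Rightarrow> 'b set \<Rightarrow> ('b \<Rightarrow> 'c set) \<Rightarrow> bool" where
  "continuous_corr \<sigma> \<rho> k U f \<longleftrightarrow>
     (\<forall>x\<in>U. \<exists>V g. openin (subtopology \<sigma> U) V \<and> x \<in> V \<and>
        (\<forall>i<k. continuous_map (subtopology \<sigma> V) \<rho> (g i)) \<and>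
        (\<forall>z\<in>V. f z = (\<lambda>i. g i z) ` {..<k}))"

definition nice ::
  "('f, 'r) fo_lang \<Rightarrow> ('f, 'r, 'a) fo_struct \<Rightarrow> 'a topology \<Rightarrow> bool" where
  "nice L M \<tau> \<longleftrightarrow>
     (\<forall>n m k U f.
        definable L M n U \<and> openin (power_topology \<tau> n) U \<and>
        correspondence k U (tuples M m) f \<and> definable L M (n + m) (corr_graph n m U f)
        \<longrightarrow> (\<exists>U0 \<subseteq> U. definable L M n U0 \<and> openin (power_topology \<tau> n) U0 \<and>
              continuous_corr (power_topology \<tau> n) (power_topology \<tau> m) k U0 f \<and>
              dimension \<tau> n (U - U0) < ereal (real n)))"


section \<open>Definable manifolds and definable groups\<close>

definition cell ::
  "('f, 'r) fo_lang \<Rightarrow> ('f, 'r, 'a) fo_struct \<Rightarrow> 'a topology \<Rightarrow> nat \<Rightarrow> (nat \<Rightarrow> 'a) set \<Rightarrow> bool" where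
  "cell L M \<tau> n C \<longleftrightarrow>
     (\<exists>i k U f \<sigma>. i \<le> n \<and>
        definable L M i U \<and> openin (power_topology \<tau> i) U \<and>
        correspondence k U (tuples M (n - i)) f \<and>
        definable L M n (corr_graph i (n - i) U f) \<and>
        continuous_corr (power_topology \<tau> i) (power_topology \<tau> (n - i)) k U f \<and>
        bij_betw \<sigma> {..<n} {..<n} \<and>
        C = coord_proj n \<sigma> ` corr_graph i (n - i) U f)"

definition has_definable_base ::
  "('f, 'r) fo_lang \<Rightarrow> ('f, 'r, 'a) fo_struct \<Rightarrow> nat \<Rightarrow> (nat \<Rightarrow> 'a) topology \<Rightarrow> bool" where
  "has_definable_base L M n \<sigma> \<longleftrightarrow> (\<exists>\<B>. is_base \<sigma> \<B> \<and> definable_family L M n \<B>)"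

definition definable_manifold ::
  "('f, 'r) fo_lang \<Rightarrow> ('f, 'r, 'a) fo_struct \<Rightarrow> 'a topology \<Rightarrow> nat \<Rightarrow> (nat \<Rightarrow> 'a) topology \<Rightarrow> bool" where
  "definable_manifold L M \<tau> n \<sigma> \<longleftrightarrow>
     definable L M n (topspace \<sigma>) \<and> has_definable_base L M n \<sigma> \<and>
     (\<exists>\<V>. finite \<V> \<and> \<Union>\<V> = topspace \<sigma> \<and>
        (\<forall>V\<in>\<V>. definable L M n V \<and> openin \<sigma> V \<and>
           (\<exists>p C W h. cell L M \<tau> p C \<and> openin (subtopology (power_topology \<tau> p) C) W \<and>
              homeomorphic_map (subtopology \<sigma> V) (subtopology (power_topology \<tau> p) W) h \<and>
              definable_map L M n p V h)))"

definition definable_group ::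
  "('f, 'r) fo_lang \<Rightarrow> ('f, 'r, 'a) fo_struct \<Rightarrow> nat \<Rightarrow> (nat \<Rightarrow> 'a) monoid \<Rightarrow> bool" where
  "definable_group L M n G \<longleftrightarrow> group G \<and> definable L M n (carrier G) \<and>
     definable L M ((n + n) + n)
       {join (n + n) n (join n n x y) (x \<otimes>\<^bsub>G\<^esub> y) | x y. x \<in> carrier G \<and> y \<in> carrier G}"

definition is_topological_group :: "'b monoid \<Rightarrow> 'b topology \<Rightarrow> bool" where
  "is_topological_group G \<sigma> \<longleftrightarrow> group G \<and> topspace \<sigma> = carrier G \<and>
     continuous_map (prod_topology \<sigma> \<sigma>) \<sigma> (\<lambda>(x, y). x \<otimes>\<^bsub>G\<^esub> y) \<and>
     continuous_map \<sigma> \<sigma> (\<lambda>x. inv\<^bsub>G\<^esub> x)"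

text \<open>The canonical topology of a definable group over a nice t-minimal theory is the unique \<open>\<sigma>\<close> with
  the following property. Uniqueness is not built in, so that a statement about every such \<open>\<sigma>\<close>
  does not presuppose it.\<close>

definition canonical_topology ::
  "('f, 'r) fo_lang \<Rightarrow> ('f, 'r, 'a) fo_struct \<Rightarrow> 'a topology \<Rightarrow> nat \<Rightarrow> (nat \<Rightarrow> 'a) monoid
     \<Rightarrow> (nat \<Rightarrow> 'a) topology \<Rightarrow> bool" where
  "canonical_topology L M \<tau> n G \<sigma> \<longleftrightarrow>
     definable_manifold L M \<tau> n \<sigma> \<and> is_topological_group G \<sigma>"

end

theory Submission
  imports Defs
begin

text \<open>A homomorphism of topological groups that is continuous on a nonempty open set is continuous,
  by translation. To find such a set, choose a chart of \<open>G\<close>; its cell is the graph of a continuous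
  correspondence over an open subset of some \<open>M\<^sup>i\<close>, hence near any of its points the graph of a single
  continuous function, so \<open>G\<close> contains an open set definably homeomorphic to an open \<open>B \<subseteq> M\<^sup>i\<close>. The
  preimages in \<open>B\<close> of the finitely many charts of \<open>H\<close> cover \<open>B\<close>, so one of them contains a nonempty
  definable open set. There \<open>f\<close> is a definable function between powers of \<open>M\<close>, and niceness, for
  1-correspondences, makes it continuous on a smaller nonempty open set. The only dimension theory
  needed is that a nonempty open subset of \<open>M\<^sup>n\<close> has dimension at least \<open>n\<close>.\<close>

section \<open>Definable predicates and relations\<close>

lemma half_pred_odd: "odd (x::nat) \<Longrightarrow> (x - Suc 0) div 2 = x div 2"
  by presburger

section \<open>Free variables and renaming of variables\<close>

lemma finite_fv_trm: "finite (fv_trm t)"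
  by (induction t) auto

text \<open>Finiteness is what leaves a fresh variable for renaming under a quantifier.\<close>

lemma finite_fv: "finite (fv \<phi>)"
  by (induction \<phi>) (auto simp: finite_fv_trm)

lemma eval_trm_cong: "(\<And>i. i \<in> fv_trm t \<Longrightarrow> e i = e' i) \<Longrightarrow> eval_trm M e t = eval_trm M e' t"
proof (induction t)
  case (App f ts)
  then have "map (eval_trm M e) ts = map (eval_trm M e') ts" by auto
  then show ?case by (simp only: eval_trm.simps)
qed simp

lemma sat_cong: "(\<And>i. i \<in> fv \<phi> \<Longrightarrow> e i = e' i) \<Longrightarrow> sat M e \<phi> = sat M e' \<phi>"
proof (induction \<phi> arbitrary: e e')
  case (Eq s t)
  then show ?case using eval_trm_cong[of s e e' M] eval_trm_cong[of t e e' M] by simp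
next
  case (Rel r ts)
  then have "map (eval_trm M e) ts = map (eval_trm M e') ts"
    by (auto intro!: eval_trm_cong)
  then show ?case by (simp only: sat.simps)
next
  case (Neg \<phi>)
  from Neg.IH[of e e'] Neg.prems show ?case by simp
next
  case (Conj \<phi> \<psi>)
  from Conj.IH(1)[of e e'] Conj.IH(2)[of e e'] Conj.prems show ?case by simp
next
  case (Exi i \<phi>)
  have "sat M (e(i := a)) \<phi> = sat M (e'(i := a)) \<phi>" for a
    using Exi.prems by (intro Exi.IH) auto
  then show ?case by simp
qed

primrec subst_trm :: "(nat \<Rightarrow> nat) \<Rightarrow> 'f trm \<Rightarrow> 'f trm" where
  "subst_trm s (Var i) = Var (s i)"
| "subst_trm s (App f ts) = App f (map (subst_trm s) ts)"

text \<open>The map \<open>s\<close> may identify variables. Under a quantifier the bound variable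
  becomes some \<open>j\<close> outside the image of \<open>fv \<phi>\<close> under
  \<open>s\<close>, so that no renamed variable is captured.\<close>

primrec subst_fm :: "('f, 'r) fm \<Rightarrow> (nat \<Rightarrow> nat) \<Rightarrow> ('f, 'r) fm" where
  "subst_fm (Eq t u) s = Eq (subst_trm s t) (subst_trm s u)"
| "subst_fm (Rel r ts) s = Rel r (map (subst_trm s) ts)"
| "subst_fm (Neg \<phi>) s = Neg (subst_fm \<phi> s)"
| "subst_fm (Conj \<phi> \<psi>) s = Conj (subst_fm \<phi> s) (subst_fm \<psi> s)"
| "subst_fm (Exi i \<phi>) s = (let j = (SOME j. j \<notin> s ` fv \<phi>) in Exi j (subst_fm \<phi> (s(i := j))))"

lemma wf_subst_trm: "wf_trm L t \<Longrightarrow> wf_trm L (subst_trm s t)"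
  by (induction t) (auto simp: list_all_iff)

lemma wf_subst_fm: "wf_fm L \<phi> \<Longrightarrow> wf_fm L (subst_fm \<phi> s)"
  by (induction \<phi> arbitrary: s) (auto simp: wf_subst_trm Let_def)

lemma eval_subst_trm: "eval_trm M e (subst_trm s t) = eval_trm M (e \<circ> s) t"
proof (induction t)
  case (App f ts)
  then have "map (eval_trm M e) (map (subst_trm s) ts) = map (eval_trm M (e \<circ> s)) ts"
    unfolding map_map by (intro map_cong) (simp_all only: comp_apply[of "eval_trm M e"])
  then show ?case by (simp only: eval_trm.simps subst_trm.simps)
qed simp

lemma sat_subst_fm: "sat M e (subst_fm \<phi> s) = sat M (e \<circ> s) \<phi>"
proof (induction \<phi> arbitrary: e s)
  case (Rel r ts)
  have "map (eval_trm M e) (map (subst_trm s) ts) = map (eval_trm M (e \<circ> s)) ts"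
    by (simp add: eval_subst_trm)
  then show ?case by (simp only: sat.simps subst_fm.simps)
next
  case (Exi i \<phi>)
  define j where "j = (SOME j. j \<notin> s ` fv \<phi>)"
  have "\<exists>j. j \<notin> s ` fv \<phi>"
    using ex_new_if_finite[of "s ` fv \<phi>"] finite_fv by blast
  then have j: "j \<notin> s ` fv \<phi>" unfolding j_def by (rule someI_ex)
  \<comment> \<open>The two assignments agree on \<open>fv \<phi>\<close>: the variable
    \<open>i\<close> reads \<open>j\<close>, and by freshness no other free variable does.\<close>
  have "sat M (e(j := a)) (subst_fm \<phi> (s(i := j))) = sat M ((e \<circ> s)(i := a)) \<phi>" for a
    unfolding Exi.IH using j by (intro sat_cong) auto
  then show ?case unfolding subst_fm.simps Let_def j_def[symmetric] sat.simps by blast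
qed (simp_all add: eval_subst_trm)

text \<open>The variables are interleaved with the parameters, so that all variables stay available and two
  lists of parameters can still be combined into one.\<close>

definition mix :: "(nat \<Rightarrow> 'a) \<Rightarrow> (nat \<Rightarrow> 'a) \<Rightarrow> nat \<Rightarrow> 'a" where
  "mix e c i = (if even i then e (i div 2) else c (i div 2))"

text \<open>Predicates of whole assignments, not of tuples: connectives, quantifiers and renamings
  then act directly, without bookkeeping of lengths. Agreement with the formula is asked only for
  assignments into the universe.\<close>

definition dpred ::
  "('f, 'r) fo_lang \<Rightarrow> ('f, 'r, 'a) fo_struct \<Rightarrow> ((nat \<Rightarrow> 'a) \<Rightarrow> bool) \<Rightarrow> bool" where
  "dpred L M P \<longleftrightarrow> (\<exists>\<phi> c. wf_fm L \<phi> \<and> range c \<subseteq> univ M \<and>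
     (\<forall>e. range e \<subseteq> univ M \<longrightarrow> P e = sat M (mix e c) \<phi>))"

section \<open>Closure properties of definable predicates\<close>

lemma dpredI:
  assumes "wf_fm L \<phi>" "range c \<subseteq> univ M"
    "\<And>e. range e \<subseteq> univ M \<Longrightarrow> P e = sat M (mix e c) \<phi>"
  shows "dpred L M P"
  using assms unfolding dpred_def by blast

lemma dpredE:
  assumes "dpred L M P"
  obtains \<phi> c where "wf_fm L \<phi>" "range c \<subseteq> univ M"
    "\<And>e. range e \<subseteq> univ M \<Longrightarrow> P e = sat M (mix e c) \<phi>"
  using assms unfolding dpred_def by blast

lemma dpred_cong:
  assumes "dpred L M P" "\<And>e. range e \<subseteq> univ M \<Longrightarrow> Q e = P e"
  shows "dpred L M Q"
  using assms unfolding dpred_def by metis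

lemma dpred_neg:
  assumes "dpred L M P" shows "dpred L M (\<lambda>e. \<not> P e)"
proof -
  from assms obtain \<phi> c where "wf_fm L \<phi>" "range c \<subseteq> univ M"
    "\<And>e. range e \<subseteq> univ M \<Longrightarrow> P e = sat M (mix e c) \<phi>" by (elim dpredE) blast
  then show ?thesis by (intro dpredI[of _ "Neg \<phi>" c]) auto
qed

lemma dpred_conj:
  assumes "dpred L M P" "dpred L M Q"
  shows "dpred L M (\<lambda>e. P e \<and> Q e)"
proof -
  from assms(1) obtain \<phi> c where P: "wf_fm L \<phi>" "range c \<subseteq> univ M"
    "\<And>e. range e \<subseteq> univ M \<Longrightarrow> P e = sat M (mix e c) \<phi>" by (elim dpredE) blast
  from assms(2) obtain \<psi> d where Q: "wf_fm L \<psi>" "range d \<subseteq> univ M"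
    "\<And>e. range e \<subseteq> univ M \<Longrightarrow> Q e = sat M (mix e d) \<psi>" by (elim dpredE) blast
  \<comment> \<open>Both renamings fix the even places, which hold the variables; \<open>?s\<close>
    sends the parameters to the even entries of \<open>mix c d\<close>, \<open>?t\<close> to the odd
    ones.\<close>
  let ?s = "\<lambda>i::nat. if even i then i else 2 * (2 * (i div 2)) + 1"
  let ?t = "\<lambda>i::nat. if even i then i else 2 * (2 * (i div 2) + 1) + 1"
  have "mix e (mix c d) \<circ> ?s = mix e c" "mix e (mix c d) \<circ> ?t = mix e d" for e
    by (auto simp: mix_def fun_eq_iff half_pred_odd)
  moreover have "range (mix c d) \<subseteq> univ M" using P(2) Q(2) by (auto simp: mix_def)
  ultimately show ?thesis
    using P Q by (intro dpredI[of _ "Conj (subst_fm \<phi> ?s) (subst_fm \<psi> ?t)" "mix c d"])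
      (auto simp: wf_subst_fm sat_subst_fm)
qed

text \<open>In \<open>mix e c\<close> the variable \<open>i\<close> sits at place
  \<open>2 * i\<close>, so that is the place to quantify.\<close>

lemma dpred_ex:
  assumes "dpred L M P"
  shows "dpred L M (\<lambda>e. \<exists>a\<in>univ M. P (e(i := a)))"
proof -
  from assms obtain \<phi> c where P: "wf_fm L \<phi>" "range c \<subseteq> univ M"
    "\<And>e. range e \<subseteq> univ M \<Longrightarrow> P e = sat M (mix e c) \<phi>" by (elim dpredE) blast
  have *: "mix (e(i := a)) c = (mix e c)(2 * i := a)" for e a
    by (auto simp: mix_def fun_eq_iff)
  have "P (e(i := a)) = sat M ((mix e c)(2 * i := a)) \<phi>"
    if "range e \<subseteq> univ M" "a \<in> univ M" for e a
    using that unfolding *[symmetric] by (intro P(3)) auto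
  with P(1,2) show ?thesis
    by (intro dpredI[of _ "Exi (2 * i) \<phi>" c]) auto
qed

text \<open>A nonempty universe supplies the parameter assignment that \<open>dpred\<close> asks
  for, although the formula mentions no parameter.\<close>

lemma dpred_eq:
  assumes "univ M \<noteq> {}"
  shows "dpred L M (\<lambda>e. e i = e j)"
proof -
  from assms obtain a where "a \<in> univ M" by blast
  then show ?thesis
    by (intro dpredI[of _ "Eq (Var (2 * i)) (Var (2 * j))" "\<lambda>_. a"]) (auto simp: mix_def)
qed

text \<open>Simultaneous replacement of variables by variables (\<open>Inl\<close>) or constants
  (\<open>Inr\<close>). Infinitely many constants are allowed, as the parameters form an infinite
  sequence.\<close>

lemma dpred_subst:
  assumes "dpred L M P" and t: "\<And>i a. t i = Inr a \<Longrightarrow> a \<in> univ M"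
  shows "dpred L M (\<lambda>e. P (\<lambda>i. case t i of Inl j \<Rightarrow> e j | Inr a \<Rightarrow> a))"
proof -
  from assms obtain \<phi> c where P: "wf_fm L \<phi>" "range c \<subseteq> univ M"
    "\<And>e. range e \<subseteq> univ M \<Longrightarrow> P e = sat M (mix e c) \<phi>" by (elim dpredE) blast
  \<comment> \<open>The constants become new parameters. Where \<open>t\<close> gives a variable,
    \<open>c 0\<close> is a filler that \<open>?s\<close> never reads.\<close>
  define d where "d i = (case t i of Inl j \<Rightarrow> c 0 | Inr a \<Rightarrow> a)" for i
  let ?s = "\<lambda>i::nat. if even i then (case t (i div 2) of Inl j \<Rightarrow> 2 * j | Inr a \<Rightarrow> 2 * (2 * (i div 2) + 1) + 1)
     else 2 * (2 * (i div 2)) + 1"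
  have *: "mix e (mix c d) \<circ> ?s = mix (\<lambda>i. case t i of Inl j \<Rightarrow> e j | Inr a \<Rightarrow> a) c" for e
    by (auto simp: mix_def fun_eq_iff d_def half_pred_odd split: sum.splits)
  have "c j \<in> univ M" for j using P(2) by auto
  then have "range d \<subseteq> univ M" using t by (auto simp: d_def split: sum.splits)
  then have "range (mix c d) \<subseteq> univ M" using P(2) by (auto simp: mix_def)
  moreover have "P (\<lambda>i. case t i of Inl j \<Rightarrow> e j | Inr a \<Rightarrow> a) =
      sat M (mix (\<lambda>i. case t i of Inl j \<Rightarrow> e j | Inr a \<Rightarrow> a) c) \<phi>" if "range e \<subseteq> univ M" for e
    using that t by (intro P(3)) (auto dest: range_subsetD split: sum.splits)
  ultimately show ?thesis using P
    by (intro dpredI[of _ "subst_fm \<phi> ?s" "mix c d"]) (auto simp: wf_subst_fm sat_subst_fm *)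
qed

lemma dpred_rename:
  assumes "dpred L M P"
  shows "dpred L M (\<lambda>e. P (\<lambda>i. e (s i)))"
  using dpred_subst[OF assms, of "\<lambda>i. Inl (s i)"] by simp

lemma dpred_eq_const:
  assumes "a \<in> univ M"
  shows "dpred L M (\<lambda>e. e i = a)"
proof -
  have ne: "univ M \<noteq> {}" using assms by auto
  \<comment> \<open>The equation between variables 0 and 1, after a substitution; the conditionals
    on numerals are its values at 0 and 1 written out.\<close>
  have "dpred L M (\<lambda>e. (case if (0::nat) = 0 then Inl i else Inr a of Inl j \<Rightarrow> e j | Inr a \<Rightarrow> a) =
      (case if (1::nat) = 0 then Inl i else Inr a of Inl j \<Rightarrow> e j | Inr a \<Rightarrow> a))"
    by (rule dpred_subst[OF dpred_eq[OF ne, of L 0 1], of "\<lambda>k. if k = 0 then Inl i else Inr a"])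
      (use assms in \<open>auto split: if_splits\<close>)
  then show ?thesis by simp
qed

lemma dpred_True:
  assumes "univ M \<noteq> {}" shows "dpred L M (\<lambda>e. True)"
  using dpred_eq[OF assms, of L 0 0] by simp

lemma dpred_all_less:
  assumes "univ M \<noteq> {}" "\<And>j. j < (n::nat) \<Longrightarrow> dpred L M (P j)"
  shows "dpred L M (\<lambda>e. \<forall>j<n. P j e)"
  using assms(2)
proof (induction n)
  case 0
  then show ?case using dpred_True[OF assms(1)] by simp
next
  case (Suc n)
  have "dpred L M (\<lambda>e. (\<forall>j<n. P j e) \<and> P n e)"
    using Suc by (intro dpred_conj) auto
  then show ?case by (rule dpred_cong) (auto simp: less_Suc_eq)
qed

section \<open>Tuples, and quantification over tuples\<close>

lemma tuples_iff: "x \<in> tuples M n \<longleftrightarrow> (\<forall>i<n. x i \<in> univ M) \<and> (\<forall>i\<ge>n. x i = undefined)"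
  by (auto simp: tuples_def PiE_iff extensional_def)

lemma restrict_in_tuples: "range e \<subseteq> univ M \<Longrightarrow> (\<lambda>i\<in>{..<n}. e (s i)) \<in> tuples M n"
  by (auto simp: tuples_iff)

lemma restrict_tuple: "x \<in> tuples M n \<Longrightarrow> (\<lambda>i\<in>{..<n}. x i) = x"
  by (auto simp: tuples_iff fun_eq_iff)

text \<open>By induction on \<open>n\<close>: the last coordinate is quantified as the value of
  variable \<open>n\<close>, the earlier ones by the induction hypothesis.\<close>

lemma dpred_ex_override:
  assumes "dpred L M P"
  shows "dpred L M (\<lambda>e. \<exists>x\<in>tuples M n. P (override_on e x {..<n}))"
proof (induction n)
  case 0
  have "tuples M 0 = {\<lambda>_. undefined}" by (auto simp: tuples_def)
  then show ?case using assms by simp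
next
  case (Suc n)
  show ?case
  proof (rule dpred_cong[OF dpred_ex[OF Suc, of n]])
    fix e
    show "(\<exists>x\<in>tuples M (Suc n). P (override_on e x {..<Suc n})) =
      (\<exists>a\<in>univ M. \<exists>x\<in>tuples M n. P (override_on (e(n := a)) x {..<n}))" (is "?l = ?r")
    proof
      assume ?l
      then obtain x where x: "x \<in> tuples M (Suc n)" "P (override_on e x {..<Suc n})" by blast
      have "override_on (e(n := x n)) (\<lambda>i\<in>{..<n}. x i) {..<n} = override_on e x {..<Suc n}"
        by (auto simp: override_on_def fun_eq_iff less_Suc_eq)
      then show ?r using x
        by (intro bexI[of _ "x n"] bexI[of _ "\<lambda>i\<in>{..<n}. x i"]) (auto simp: tuples_iff)
    next
      assume ?r
      then obtain a x where x: "a \<in> univ M" "x \<in> tuples M n" "P (override_on (e(n := a)) x {..<n})"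
        by blast
      have "override_on (e(n := a)) x {..<n} = override_on e (x(n := a)) {..<Suc n}"
        by (auto simp: override_on_def fun_eq_iff less_Suc_eq)
      then show ?l using x
        by (intro bexI[of _ "x(n := a)"]) (auto simp: tuples_iff)
    qed
  qed
qed

text \<open>The body receives the tuple in its first \<open>n\<close> variables and the surrounding
  assignment shifted up by \<open>n\<close>; the renaming by \<open>i - n\<close> undoes the
  shift.\<close>

lemma dpred_ex_tuple:
  assumes "dpred L M (\<lambda>e. Q (\<lambda>i\<in>{..<n}. e i) (\<lambda>i. e (n + i)))"
  shows "dpred L M (\<lambda>e. \<exists>x\<in>tuples M n. Q x e)"
  by (rule dpred_cong[OF dpred_rename[OF dpred_ex_override[OF assms, of n], of "\<lambda>i. i - n"]])
    (auto simp: override_on_def restrict_tuple cong: restrict_cong bex_cong)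

text \<open>The bridge from \<open>definable\<close> to \<open>dpred\<close>: definability can
  henceforth be proved by writing down a condition on assignments.\<close>

lemma definable_iff:
  assumes ne: "univ M \<noteq> {}"
  shows "definable L M n X \<longleftrightarrow> X \<subseteq> tuples M n \<and> dpred L M (\<lambda>e. (\<lambda>i\<in>{..<n}. e i) \<in> X)"
proof
  assume "definable L M n X"
  then obtain \<phi> c where *: "wf_fm L \<phi>" "range c \<subseteq> univ M"
    "X = {x \<in> tuples M n. sat M (override_on c x {..<n}) \<phi>}" unfolding definable_def by blast
  let ?s = "\<lambda>i. if i < n then 2 * i else 2 * i + 1"
  have "mix e c \<circ> ?s = override_on c (\<lambda>i\<in>{..<n}. e i) {..<n}" for e
    by (auto simp: mix_def fun_eq_iff override_on_def)
  then have "dpred L M (\<lambda>e. (\<lambda>i\<in>{..<n}. e i) \<in> X)"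
    using *(1,2) by (intro dpredI[of _ "subst_fm \<phi> ?s" c])
      (auto simp: wf_subst_fm sat_subst_fm *(3) tuples_iff)
  then show "X \<subseteq> tuples M n \<and> dpred L M (\<lambda>e. (\<lambda>i\<in>{..<n}. e i) \<in> X)" using *(3) by auto
next
  assume X: "X \<subseteq> tuples M n \<and> dpred L M (\<lambda>e. (\<lambda>i\<in>{..<n}. e i) \<in> X)"
  then obtain \<phi> c where *: "wf_fm L \<phi>" "range c \<subseteq> univ M"
    "\<And>e. range e \<subseteq> univ M \<Longrightarrow> (\<lambda>i\<in>{..<n}. e i) \<in> X \<longleftrightarrow> sat M (mix e c) \<phi>"
    by (elim conjE dpredE) blast
  \<comment> \<open>Variables from \<open>n\<close> on do not affect membership in \<open>X\<close>;
    all go to place \<open>n\<close>, where truncated subtraction makes \<open>d n = c 0\<close>.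
    The parameters start at place \<open>n + 1\<close>.\<close>
  let ?s = "\<lambda>i. if even i then (if i div 2 < n then i div 2 else n) else n + 1 + i div 2"
  define d where "d i = c (i - (n + 1))" for i
  have "x \<in> X \<longleftrightarrow> sat M (override_on d x {..<n}) (subst_fm \<phi> ?s)" if x: "x \<in> tuples M n" for x
  proof -
    define e where "e i = (if i < n then x i else c 0)" for i
    have "(\<lambda>i\<in>{..<n}. e i) = x" using restrict_tuple[OF x] by (simp add: e_def cong: restrict_cong)
    moreover have "override_on d x {..<n} \<circ> ?s = mix e c"
      by (auto simp: mix_def fun_eq_iff override_on_def e_def d_def)
    moreover have "range e \<subseteq> univ M" using x *(2) by (auto simp: e_def tuples_iff)
    ultimately show ?thesis using *(3)[of e] by (simp add: sat_subst_fm)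
  qed
  then have "X = {x \<in> tuples M n. sat M (override_on d x {..<n}) (subst_fm \<phi> ?s)}"
    using X by blast
  moreover have "range d \<subseteq> univ M" using *(2) by (auto simp: d_def)
  ultimately show "definable L M n X"
    unfolding definable_def using *(1) wf_subst_fm by blast
qed

lemma definable_subset: "definable L M n X \<Longrightarrow> X \<subseteq> tuples M n"
  by (auto simp: definable_def)

lemma dpred_definable:
  assumes "univ M \<noteq> {}" "definable L M n X"
  shows "dpred L M (\<lambda>e. (\<lambda>i\<in>{..<n}. e (s i)) \<in> X)"
proof -
  have "dpred L M (\<lambda>e. (\<lambda>i\<in>{..<n}. e i) \<in> X)"
    using assms(2) unfolding definable_iff[OF assms(1)] by simp
  from dpred_rename[OF this, of s] show ?thesis .
qed

lemma definableI:
  assumes "univ M \<noteq> {}" "X \<subseteq> tuples M n" "dpred L M P"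
    "\<And>e. range e \<subseteq> univ M \<Longrightarrow> (\<lambda>i\<in>{..<n}. e i) \<in> X \<longleftrightarrow> P e"
  shows "definable L M n X"
  using assms dpred_cong[OF assms(3)] by (simp add: definable_iff)

lemma definable_Int:
  assumes "univ M \<noteq> {}" "definable L M n X" "definable L M n Y"
  shows "definable L M n (X \<inter> Y)"
  using definable_subset[OF assms(2)]
  by (intro definableI[OF assms(1) _ dpred_conj[OF dpred_definable[OF assms(1,2)] dpred_definable[OF assms(1,3)]]])
    auto

lemma join_in_tuples [simp]: "x \<in> tuples M n \<Longrightarrow> y \<in> tuples M m \<Longrightarrow> join n m x y \<in> tuples M (n + m)"
  by (auto simp: join_def tuples_iff)

lemma join_eq_iff:
  assumes "x \<in> tuples M n" "y \<in> tuples M m" "x' \<in> tuples M n" "y' \<in> tuples M m"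
  shows "join n m x y = join n m x' y' \<longleftrightarrow> x = x' \<and> y = y'"
proof
  assume "join n m x y = join n m x' y'"
  then have eq: "join n m x y i = join n m x' y' i" for i by simp
  have "x i = x' i" for i
    using eq[of i] assms(1,3) by (cases "i < n") (auto simp: join_def tuples_iff)
  moreover have "y i = y' i" for i
    using eq[of "n + i"] assms(2,4)
    by (cases "i < m") (auto simp: join_def tuples_iff)
  ultimately show "x = x' \<and> y = y'" by auto
qed simp

lemma restrict_join:
  "(\<lambda>i\<in>{..<n + m}. e i) = join n m (\<lambda>i\<in>{..<n}. e i) (\<lambda>i\<in>{..<m}. e (n + i))"
  by (auto simp: join_def fun_eq_iff)

section \<open>Definable relations between powers of the universe\<close>

text \<open>Pairs instead of joined tuples, so that inverting and composing maps become converse and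
  relational composition of their graphs.\<close>

definition definable_rel ::
  "('f, 'r) fo_lang \<Rightarrow> ('f, 'r, 'a) fo_struct \<Rightarrow> nat \<Rightarrow> nat \<Rightarrow> ((nat \<Rightarrow> 'a) \<times> (nat \<Rightarrow> 'a)) set \<Rightarrow> bool" where
  "definable_rel L M n m R \<longleftrightarrow> R \<subseteq> tuples M n \<times> tuples M m \<and>
     definable L M (n + m) ((\<lambda>(x, y). join n m x y) ` R)"

lemma definable_rel_iff:
  assumes ne: "univ M \<noteq> {}"
  shows "definable_rel L M n m R \<longleftrightarrow> R \<subseteq> tuples M n \<times> tuples M m \<and>
     dpred L M (\<lambda>e. ((\<lambda>i\<in>{..<n}. e i), (\<lambda>i\<in>{..<m}. e (n + i))) \<in> R)" (is "_ \<longleftrightarrow> _ \<and> ?D")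
proof (cases "R \<subseteq> tuples M n \<times> tuples M m")
  case R: True
  have "(\<lambda>i\<in>{..<n + m}. e i) \<in> (\<lambda>(x, y). join n m x y) ` R \<longleftrightarrow>
      ((\<lambda>i\<in>{..<n}. e i), (\<lambda>i\<in>{..<m}. e (n + i))) \<in> R" if e: "range e \<subseteq> univ M" for e
  proof -
    have *: "(\<lambda>i\<in>{..<n}. e i) \<in> tuples M n" "(\<lambda>i\<in>{..<m}. e (n + i)) \<in> tuples M m"
      using e by (auto simp: tuples_iff)
    show ?thesis unfolding restrict_join using R
      by (force simp: join_eq_iff[OF *] image_iff)
  qed
  then have "dpred L M (\<lambda>e. (\<lambda>i\<in>{..<n + m}. e i) \<in> (\<lambda>(x, y). join n m x y) ` R) \<longleftrightarrow> ?D"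
    using dpred_cong by (smt (verit, ccfv_threshold))
  moreover have "(\<lambda>(x, y). join n m x y) ` R \<subseteq> tuples M (n + m)" using R by auto
  ultimately show ?thesis using R unfolding definable_rel_def definable_iff[OF ne] by simp
qed (simp add: definable_rel_def)

lemma dpred_rel:
  assumes "univ M \<noteq> {}" "definable_rel L M n m R"
  shows "dpred L M (\<lambda>e. ((\<lambda>i\<in>{..<n}. e (s i)), (\<lambda>i\<in>{..<m}. e (t i))) \<in> R)"
proof -
  have "dpred L M (\<lambda>e. ((\<lambda>i\<in>{..<n}. e i), (\<lambda>i\<in>{..<m}. e (n + i))) \<in> R)"
    using assms(2) unfolding definable_rel_iff[OF assms(1)] by simp
  from dpred_rename[OF this, of "\<lambda>i. if i < n then s i else t (i - n)"]
  show ?thesis by (simp cong: restrict_cong)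
qed

lemma definable_relI:
  assumes "univ M \<noteq> {}" "R \<subseteq> tuples M n \<times> tuples M m" "dpred L M P"
    "\<And>e. range e \<subseteq> univ M \<Longrightarrow> ((\<lambda>i\<in>{..<n}. e i), (\<lambda>i\<in>{..<m}. e (n + i))) \<in> R \<longleftrightarrow> P e"
  shows "definable_rel L M n m R"
  using assms dpred_cong[OF assms(3)] by (simp add: definable_rel_iff)

lemma definable_rel_converse:
  assumes "univ M \<noteq> {}" "definable_rel L M n m R"
  shows "definable_rel L M m n (R\<inverse>)"
  using assms(2)
  by (intro definable_relI[OF assms(1) _ dpred_rel[OF assms, of "\<lambda>i. m + i" "\<lambda>i. i"]])
    (auto simp: definable_rel_def)

lemma definable_rel_comp:
  assumes "univ M \<noteq> {}" "definable_rel L M n m R" "definable_rel L M m k S"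
  shows "definable_rel L M n k (R O S)"
proof (rule definable_relI[OF assms(1)])
  show "R O S \<subseteq> tuples M n \<times> tuples M k" using assms(2,3) by (auto simp: definable_rel_def)
  show "dpred L M (\<lambda>e. \<exists>y\<in>tuples M m. ((\<lambda>i\<in>{..<n}. e i), y) \<in> R \<and> (y, (\<lambda>i\<in>{..<k}. e (n + i))) \<in> S)"
    by (intro dpred_ex_tuple dpred_conj) (rule dpred_rel[OF assms(1,2)] dpred_rel[OF assms(1,3)])+
  fix e
  have "R \<subseteq> tuples M n \<times> tuples M m" using assms(2) by (simp add: definable_rel_def)
  then show "((\<lambda>i\<in>{..<n}. e i), (\<lambda>i\<in>{..<k}. e (n + i))) \<in> R O S \<longleftrightarrow>
    (\<exists>y\<in>tuples M m. ((\<lambda>i\<in>{..<n}. e i), y) \<in> R \<and> (y, (\<lambda>i\<in>{..<k}. e (n + i))) \<in> S)"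
    by blast
qed

lemma definable_Domain:
  assumes "univ M \<noteq> {}" "definable_rel L M n m R"
  shows "definable L M n (Domain R)"
proof (rule definableI[OF assms(1)])
  have R: "R \<subseteq> tuples M n \<times> tuples M m" using assms(2) by (simp add: definable_rel_def)
  then show "Domain R \<subseteq> tuples M n" by auto
  show "dpred L M (\<lambda>e. \<exists>y\<in>tuples M m. ((\<lambda>i\<in>{..<n}. e i), y) \<in> R)"
    by (intro dpred_ex_tuple) (rule dpred_rel[OF assms])
  show "(\<lambda>i\<in>{..<n}. e i) \<in> Domain R \<longleftrightarrow> (\<exists>y\<in>tuples M m. ((\<lambda>i\<in>{..<n}. e i), y) \<in> R)" for e
    using R by blast
qed

lemma definable_rel_restrict:
  assumes "univ M \<noteq> {}" "definable_rel L M n m R" "definable L M n X"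
  shows "definable_rel L M n m {(x, y) \<in> R. x \<in> X}"
proof (rule definable_relI[OF assms(1)])
  show "{(x, y) \<in> R. x \<in> X} \<subseteq> tuples M n \<times> tuples M m" using assms(2) by (auto simp: definable_rel_def)
  show "dpred L M (\<lambda>e. ((\<lambda>i\<in>{..<n}. e i), (\<lambda>i\<in>{..<m}. e (n + i))) \<in> R \<and> (\<lambda>i\<in>{..<n}. e i) \<in> X)"
    by (intro dpred_conj dpred_rel[OF assms(1,2)] dpred_definable[OF assms(1,3)])
qed auto

lemma definable_map_rel:
  assumes "f ` X \<subseteq> tuples M m" "X \<subseteq> tuples M n"
  shows "definable_map L M n m X f \<longleftrightarrow> definable_rel L M n m ((\<lambda>x. (x, f x)) ` X)"
  using assms unfolding definable_map_def definable_rel_def by (auto simp: image_image)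

section \<open>Fibres, families and boxes\<close>

text \<open>The coordinates of \<open>b\<close> become parameters: \<open>t\<close> replaces the
  first \<open>k\<close> variables by constants and moves the others down by
  \<open>k\<close>.\<close>

lemma definable_fibre:
  fixes M :: "('f, 'r, 'a) fo_struct"
  assumes "univ M \<noteq> {}" "definable L M (k + n) D" "b \<in> tuples M k"
  shows "definable L M n {x \<in> tuples M n. join k n b x \<in> D}"
proof (rule definableI[OF assms(1)])
  define t where "t i = (if i < k then Inr (b i) else Inl (i - k))" for i
  show "dpred L M (\<lambda>e. (\<lambda>i\<in>{..<k + n}. case t i of Inl j \<Rightarrow> e j | Inr a \<Rightarrow> a) \<in> D)"
    using assms(3)
    by (intro dpred_subst[where P = "\<lambda>e. (\<lambda>i\<in>{..<k + n}. e i) \<in> D"] dpred_definable[OF assms(1,2)])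
      (auto simp: t_def tuples_iff split: if_splits)
  fix e :: "nat \<Rightarrow> 'a" assume e: "range e \<subseteq> univ M"
  have "(\<lambda>i\<in>{..<k + n}. case t i of Inl j \<Rightarrow> e j | Inr a \<Rightarrow> a) = join k n b (\<lambda>i\<in>{..<n}. e i)"
    by (auto simp: join_def fun_eq_iff t_def)
  then show "(\<lambda>i\<in>{..<n}. e i) \<in> {x \<in> tuples M n. join k n b x \<in> D} \<longleftrightarrow>
      (\<lambda>i\<in>{..<k + n}. case t i of Inl j \<Rightarrow> e j | Inr a \<Rightarrow> a) \<in> D"
    using restrict_in_tuples[OF e, of "\<lambda>i. i"] by simp
qed auto

lemma definable_family_member:
  assumes "univ M \<noteq> {}" "definable_family L M n \<F>" "X \<in> \<F>"
  shows "definable L M n X"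
proof -
  obtain k Y D where *: "definable L M k Y" "definable L M (k + n) D"
    "\<F> = (\<lambda>b. {x \<in> tuples M n. join k n b x \<in> D}) ` Y"
    using assms(2) unfolding definable_family_def by blast
  with assms(3) obtain b where "b \<in> Y" "X = {x \<in> tuples M n. join k n b x \<in> D}" by blast
  then show ?thesis using definable_fibre[OF assms(1) *(2)] definable_subset[OF *(1)] by blast
qed

text \<open>A box is a finite conjunction of conditions on single coordinates, whose separate
  parameters \<open>dpred_all_less\<close> merges.\<close>

lemma definable_box:
  assumes "univ M \<noteq> {}" "\<And>i. i < n \<Longrightarrow> definable1 L M (B i)"
  shows "definable L M n (Pi\<^sub>E {..<n} B)"
proof (rule definableI[OF assms(1)])
  have B: "B i \<subseteq> univ M" if "i < n" for i
  proof
    fix a assume "a \<in> B i"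
    then have "singleton_tuple a \<in> tuples M 1"
      using definable_subset assms(2)[OF that] unfolding definable1_def by fast
    then show "a \<in> univ M" by (simp add: singleton_tuple_def tuples_iff)
  qed
  then show "Pi\<^sub>E {..<n} B \<subseteq> tuples M n" unfolding tuples_def by (intro PiE_mono) auto
  show "dpred L M (\<lambda>e. \<forall>i<n. (\<lambda>j\<in>{..<1}. e i) \<in> singleton_tuple ` B i)"
    using assms(2) unfolding definable1_def
    by (intro dpred_all_less[OF assms(1)] dpred_definable[OF assms(1), where s = "\<lambda>_. i" for i])
  have "(\<lambda>j\<in>{..<1}. a) \<in> singleton_tuple ` A \<longleftrightarrow> a \<in> A" for a :: 'a and A
    unfolding singleton_tuple_def by (auto simp: image_iff fun_eq_iff)
  then show "(\<lambda>i\<in>{..<n}. e i) \<in> Pi\<^sub>E {..<n} B \<longleftrightarrow> (\<forall>i<n. (\<lambda>j\<in>{..<1}. e i) \<in> singleton_tuple ` B i)" for e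
    by (auto simp: PiE_iff)
qed


section \<open>Definable functions on open sets\<close>

lemma coord_proj_continuous:
  assumes "\<And>j. j < k \<Longrightarrow> s j < n"
  shows "continuous_map (power_topology \<tau> n) (power_topology \<tau> k) (coord_proj k s)"
  using assms unfolding power_topology_def coord_proj_def continuous_map_componentwise
  by (auto intro!: continuous_map_product_projection)

lemma join_continuous:
  assumes "continuous_map X (power_topology \<tau> n) f" "continuous_map X (power_topology \<tau> m) g"
  shows "continuous_map X (power_topology \<tau> (n + m)) (\<lambda>x. join n m (f x) (g x))"
  unfolding power_topology_def continuous_map_componentwise
proof (intro conjI ballI)
  show "(\<lambda>x. join n m (f x) (g x)) ` topspace X \<subseteq> extensional {..<n + m}"
    by (auto simp: join_def)
  fix k assume k: "k \<in> {..<n + m}"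
  show "continuous_map X \<tau> (\<lambda>x. join n m (f x) (g x) k)"
  proof (cases "k < n")
    case True
    with assms(1) k show ?thesis
      by (auto simp: join_def power_topology_def continuous_map_componentwise)
  next
    case False
    moreover have "k - n < m" using k False by auto
    ultimately show ?thesis using assms(2) k
      by (auto simp: join_def power_topology_def continuous_map_componentwise)
  qed
qed

lemma continuous_map_preimage_open:
  assumes "continuous_map (subtopology X S) Y g" "openin X S" "openin Y T"
  shows "openin X {x \<in> S. g x \<in> T}"
proof -
  have "openin (subtopology X S) {x \<in> topspace (subtopology X S). g x \<in> T}"
    using assms(1,3) by (rule openin_continuous_map_preimage)
  moreover have "topspace (subtopology X S) = S"
    using openin_subset[OF assms(2)] by auto
  ultimately show ?thesis using openin_trans_full assms(2) by metis
qed

section \<open>Topology of a t-minimal structure\<close>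

locale t_minimal_structure =
  fixes L :: "('f, 'r) fo_lang" and M :: "('f, 'r, 'a) fo_struct" and \<tau> :: "'a topology"
  assumes t_min: "t_minimal_topology L M \<tau>" and ne: "univ M \<noteq> {}"
begin

lemma topspace_\<tau>: "topspace \<tau> = univ M" and Hausdorff_\<tau>: "Hausdorff_space \<tau>"
  using t_min by (auto simp: t_minimal_topology_def)

lemma topspace_power [simp]: "topspace (power_topology \<tau> n) = tuples M n"
  by (simp add: power_topology_def tuples_def topspace_\<tau>)

lemma Hausdorff_power: "Hausdorff_space (power_topology \<tau> n)"
  by (simp add: power_topology_def Hausdorff_space_product_topology Hausdorff_\<tau>)

text \<open>The universe is definable and is its own interior, so t-minimality applies to it. Two
  distinct values for an indicator function come from here.\<close>

lemma infinite_univ: "infinite (univ M)"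
proof -
  have "singleton_tuple ` univ M = Pi\<^sub>E {..<1} (\<lambda>_. univ M)"
  proof (intro equalityI subsetI)
    fix x :: "nat \<Rightarrow> 'a" assume "x \<in> Pi\<^sub>E {..<1} (\<lambda>_. univ M)"
    then have "x = singleton_tuple (x 0)" "x 0 \<in> univ M"
      by (auto simp: singleton_tuple_def PiE_iff extensional_def fun_eq_iff)
    then show "x \<in> singleton_tuple ` univ M" by blast
  qed (auto simp: singleton_tuple_def split: if_splits)
  then have eq: "singleton_tuple ` univ M = tuples M 1" by (simp add: tuples_def)
  have "definable L M 1 (singleton_tuple ` univ M)"
    unfolding eq by (rule definableI[OF ne order_refl dpred_True[OF ne]])
      (simp only: restrict_in_tuples[where s = "\<lambda>i. i"])
  then have "\<tau> interior_of (univ M) \<noteq> {} \<longleftrightarrow> infinite (univ M)"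
    using t_min by (simp add: t_minimal_topology_def definable1_def)
  moreover have "\<tau> interior_of (univ M) = univ M"
    by (metis interior_of_topspace topspace_\<tau>)
  ultimately show ?thesis using ne by auto
qed

text \<open>Members of the definable basis are themselves definable, being fibres of one definable
  set.\<close>

lemma definable_nbhd1:
  assumes "openin \<tau> S" "a \<in> S"
  obtains B where "openin \<tau> B" "definable1 L M B" "a \<in> B" "B \<subseteq> S"
proof -
  obtain \<B> where \<B>: "is_base \<tau> \<B>" "definable_family L M 1 ((`) singleton_tuple ` \<B>)"
    using t_min by (auto simp: t_minimal_topology_def)
  have open_iff: "openin \<tau> U \<longleftrightarrow> (\<exists>\<U>\<subseteq>\<B>. \<Union>\<U> = U)" for U
    using \<B>(1) by (auto simp: is_base_def union_of_def arbitrary_def)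
  obtain \<U> where "\<U> \<subseteq> \<B>" "\<Union>\<U> = S" using assms(1) unfolding open_iff by blast
  then obtain B where B: "B \<in> \<B>" "a \<in> B" "B \<subseteq> S" using assms(2) by blast
  have "openin \<tau> B" unfolding open_iff using B(1) by (intro exI[of _ "{B}"]) auto
  moreover have "definable1 L M B"
    unfolding definable1_def using B(1) by (intro definable_family_member[OF ne \<B>(2)] imageI)
  ultimately show thesis using that B by blast
qed

text \<open>A basic box inside \<open>S\<close> is refined coordinate by coordinate. Continuity
  arguments produce open sets that may fail to be definable, while niceness speaks of definable
  ones; this shrinking mediates.\<close>

lemma definable_nbhd:
  assumes "openin (power_topology \<tau> n) S" "x \<in> S"
  obtains B where "openin (power_topology \<tau> n) B" "definable L M n B" "x \<in> B" "B \<subseteq> S"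
proof -
  have "\<exists>V. finite {i \<in> {..<n}. V i \<noteq> topspace \<tau>} \<and> (\<forall>i\<in>{..<n}. openin \<tau> (V i)) \<and>
      x \<in> Pi\<^sub>E {..<n} V \<and> Pi\<^sub>E {..<n} V \<subseteq> S"
    using assms unfolding power_topology_def openin_product_topology_alt by (elim bspec)
  then obtain V where V: "\<forall>i\<in>{..<n}. openin \<tau> (V i)" "x \<in> Pi\<^sub>E {..<n} V" "Pi\<^sub>E {..<n} V \<subseteq> S"
    by (elim exE conjE)
  have "\<exists>B. openin \<tau> B \<and> definable1 L M B \<and> x i \<in> B \<and> B \<subseteq> V i" if "i < n" for i
    using definable_nbhd1[of "V i" "x i"] V(1,2) that by (metis PiE_mem lessThan_iff)
  then obtain B where B: "\<And>i. i < n \<Longrightarrow> openin \<tau> (B i) \<and> definable1 L M (B i) \<and> x i \<in> B i \<and> B i \<subseteq> V i"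
    by metis
  show thesis
  proof
    show "openin (power_topology \<tau> n) (Pi\<^sub>E {..<n} B)"
      unfolding power_topology_def using B by (simp add: openin_PiE)
    show "definable L M n (Pi\<^sub>E {..<n} B)" using B by (intro definable_box[OF ne]) auto
    show "x \<in> Pi\<^sub>E {..<n} B" using B V(2) by (auto simp: PiE_iff)
    show "Pi\<^sub>E {..<n} B \<subseteq> S" using B PiE_mono[of "{..<n}" B V] V(3) by auto
  qed
qed

section \<open>Generic continuity and finite definable covers\<close>

text \<open>Projecting to all \<open>n\<close> coordinates is the identity on \<open>U\<close>, so
  \<open>n\<close> is among the candidates for the maximum. These are bounded by \<open>n\<close>,
  because a strictly increasing \<open>\<sigma>\<close> is injective, so \<open>Max\<close> is
  meaningful.\<close>

lemma dimension_open:
  assumes "openin (power_topology \<tau> n) U" "U \<noteq> {}"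
  shows "dimension \<tau> n U \<ge> ereal (real n)"
proof -
  let ?K = "{k. \<exists>\<sigma>. strict_mono_on {..<k} \<sigma> \<and> \<sigma> ` {..<k} \<subseteq> {..<n} \<and>
                               power_topology \<tau> k interior_of (coord_proj k \<sigma> ` U) \<noteq> {}}"
  have "k \<le> n" if k: "k \<in> ?K" for k
  proof -
    obtain \<sigma> where "strict_mono_on {..<k} \<sigma>" "\<sigma> ` {..<k} \<subseteq> {..<n}" using k by blast
    then show ?thesis
      using card_inj_on_le[of \<sigma> "{..<k}" "{..<n}"] strict_mono_on_imp_inj_on by auto
  qed
  then have "?K \<subseteq> {..n}" by (intro subsetI) (simp only: atMost_iff)
  then have fin: "finite ?K" by (rule finite_subset) simp
  have "coord_proj n (\<lambda>i. i) x = x" if "x \<in> U" for x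
    using restrict_tuple openin_subset[OF assms(1)] that by (auto simp: coord_proj_def)
  then have "coord_proj n (\<lambda>i. i) ` U = U" by simp
  then have "n \<in> ?K" using assms
    by (auto intro!: exI[of _ "\<lambda>i. i"] simp: strict_mono_on_def interior_of_openin)
  then have "n \<le> Max ?K" using fin by simp
  then show ?thesis using assms(2) by (simp add: dimension_def)
qed

text \<open>A function is the 1-correspondence with values \<open>{F x}\<close>. Niceness gives
  continuity off a set of dimension below \<open>n\<close>, and a nonempty open \<open>U\<close> is
  too large to be such a set.\<close>

lemma definable_function_continuous:
  assumes nice: "nice L M \<tau>"
    and U: "definable L M n U" "openin (power_topology \<tau> n) U" "U \<noteq> {}"
    and F: "definable_rel L M n m ((\<lambda>x. (x, F x)) ` U)"
  obtains U0 where "U0 \<subseteq> U" "definable L M n U0" "openin (power_topology \<tau> n) U0" "U0 \<noteq> {}"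
    "continuous_map (subtopology (power_topology \<tau> n) U0) (power_topology \<tau> m) F"
proof -
  let ?P = "power_topology \<tau> n"
  have FU: "F x \<in> tuples M m" if "x \<in> U" for x using F that by (auto simp: definable_rel_def)
  have "corr_graph n m U (\<lambda>x. {F x}) = (\<lambda>(x, y). join n m x y) ` (\<lambda>x. (x, F x)) ` U"
    by (auto simp: corr_graph_def)
  then have "definable L M (n + m) (corr_graph n m U (\<lambda>x. {F x}))"
    using F by (simp add: definable_rel_def)
  moreover have "correspondence 1 U (tuples M m) (\<lambda>x. {F x})"
    using FU by (auto simp: correspondence_def)
  ultimately have "\<exists>U0 \<subseteq> U. definable L M n U0 \<and> openin ?P U0 \<and>
      continuous_corr ?P (power_topology \<tau> m) 1 U0 (\<lambda>x. {F x}) \<and>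
      dimension \<tau> n (U - U0) < ereal (real n)"
    using U(1,2) by (intro nice[unfolded nice_def, rule_format]) simp
  then obtain U1 where U1: "U1 \<subseteq> U" "openin ?P U1"
    "continuous_corr ?P (power_topology \<tau> m) 1 U1 (\<lambda>x. {F x})" "dimension \<tau> n (U - U1) < ereal (real n)"
    by blast
  \<comment> \<open>Were \<open>U1\<close> empty, \<open>U - U1\<close> would be \<open>U\<close>,
    of dimension at least \<open>n\<close>.\<close>
  have "U1 \<noteq> {}" using U1(4) dimension_open[OF U(2,3)] by auto
  then obtain x where x: "x \<in> U1" by blast
  from U1(3)[unfolded continuous_corr_def, rule_format, OF x] obtain V g where
    V: "openin (subtopology ?P U1) V" "x \<in> V"
    and g: "\<forall>i<1. continuous_map (subtopology ?P V) (power_topology \<tau> m) (g i)"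
      "\<forall>z\<in>V. {F z} = (\<lambda>i. g i z) ` {..<1::nat}"
    by (elim exE conjE)
  have g0: "continuous_map (subtopology ?P V) (power_topology \<tau> m) (g 0)" "g 0 z = F z" if "z \<in> V" for z
    using g that by auto
  have V_open: "openin ?P V" using V(1) U1(2) openin_trans_full by blast
  \<comment> \<open>On \<open>V\<close> the only branch \<open>g 0\<close> coincides with
    \<open>F\<close>; a definable open piece of \<open>V\<close> is what remains to be
    chosen.\<close>
  obtain B where B: "openin ?P B" "definable L M n B" "x \<in> B" "B \<subseteq> V"
    using definable_nbhd[OF V_open V(2)] .
  have "continuous_map (subtopology ?P B) (power_topology \<tau> m) F"
  proof (rule continuous_map_eq)
    show "continuous_map (subtopology ?P B) (power_topology \<tau> m) (g 0)"
      using g0(1)[OF V(2)] B(4) by (rule continuous_map_from_subtopology_mono)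
  qed (use g0(2) B(4) in auto)
  moreover have "V \<subseteq> U1" using V(1) openin_imp_subset by blast
  ultimately show thesis using that[of B] B U1(1) by blast
qed

text \<open>Niceness applied to a two-valued indicator function: its locus of continuity splits into the
  two open pieces on which it is constant.\<close>

lemma definable_split_interior:
  assumes nice: "nice L M \<tau>"
    and U: "definable L M n U" "openin (power_topology \<tau> n) U" "U \<noteq> {}"
    and X: "definable L M n X"
  obtains U0 where "U0 \<subseteq> U" "definable L M n U0" "openin (power_topology \<tau> n) U0" "U0 \<noteq> {}"
    "U0 \<subseteq> X \<or> U0 \<inter> X = {}"
proof -
  obtain a b where ab: "a \<in> univ M" "b \<in> univ M" "a \<noteq> b"
    using infinite_univ by (metis finite.emptyI finite_insert finite_subset insertI1 insert_iff subsetI)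
  define F where "F x = singleton_tuple (if x \<in> X then a else b)" for x
  have "definable_rel L M n 1 ((\<lambda>x. (x, F x)) ` U)"
  proof (rule definable_relI[OF ne])
    show "(\<lambda>x. (x, F x)) ` U \<subseteq> tuples M n \<times> tuples M 1"
      using definable_subset[OF U(1)] ab by (auto simp: F_def singleton_tuple_def tuples_iff)
    \<comment> \<open>The negations spell a disjunction: value \<open>a\<close> on \<open>X\<close>,
      or value \<open>b\<close> off \<open>X\<close>.\<close>
    show "dpred L M (\<lambda>e. (\<lambda>i\<in>{..<n}. e i) \<in> U \<and>
       \<not> (\<not> ((\<lambda>i\<in>{..<n}. e i) \<in> X \<and> e n = a) \<and> \<not> (\<not> (\<lambda>i\<in>{..<n}. e i) \<in> X \<and> e n = b)))"
      by (intro dpred_conj dpred_neg dpred_definable[OF ne U(1)] dpred_definable[OF ne X]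
          dpred_eq_const ab)
    have "(\<lambda>i\<in>{..<1}. e (n + i)) = singleton_tuple c \<longleftrightarrow> e n = c" for e and c :: 'a
      by (auto simp: singleton_tuple_def fun_eq_iff)
    then show "(\<lambda>i\<in>{..<n}. e i, \<lambda>i\<in>{..<1}. e (n + i)) \<in> (\<lambda>x. (x, F x)) ` U \<longleftrightarrow>
       (\<lambda>i\<in>{..<n}. e i) \<in> U \<and>
       \<not> (\<not> ((\<lambda>i\<in>{..<n}. e i) \<in> X \<and> e n = a) \<and> \<not> (\<not> (\<lambda>i\<in>{..<n}. e i) \<in> X \<and> e n = b))" for e
      by (auto simp: image_iff F_def)
  qed
  from definable_function_continuous[OF nice U this]
  obtain U1 where U1: "U1 \<subseteq> U" "definable L M n U1" "openin (power_topology \<tau> n) U1" "U1 \<noteq> {}"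
    and cont: "continuous_map (subtopology (power_topology \<tau> n) U1) (power_topology \<tau> 1) F" .
  have cont0: "continuous_map (subtopology (power_topology \<tau> n) U1) \<tau> (\<lambda>x. F x 0)"
    using cont by (auto simp: power_topology_def continuous_map_componentwise)
  have F0: "F x 0 = (if x \<in> X then a else b)" for x by (simp add: F_def singleton_tuple_def)
  \<comment> \<open>Points are closed in a Hausdorff space, so avoiding one of the two values is an
    open condition on \<open>U1\<close>.\<close>
  have op: "openin \<tau> (topspace \<tau> - {c})" if "c \<in> univ M" for c
    using closedin_Hausdorff_singleton[OF Hausdorff_\<tau>, of c] that topspace_\<tau> by blast
  have "openin (power_topology \<tau> n) {x \<in> U1. F x 0 \<in> topspace \<tau> - {b}}"
    by (rule continuous_map_preimage_open[OF cont0 U1(3) op[OF ab(2)]])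
  moreover have "{x \<in> U1. F x 0 \<in> topspace \<tau> - {b}} = U1 \<inter> X"
    using ab by (auto simp: F0 topspace_\<tau>)
  ultimately have o1: "openin (power_topology \<tau> n) (U1 \<inter> X)" by simp
  have "openin (power_topology \<tau> n) {x \<in> U1. F x 0 \<in> topspace \<tau> - {a}}"
    by (rule continuous_map_preimage_open[OF cont0 U1(3) op[OF ab(1)]])
  moreover have "{x \<in> U1. F x 0 \<in> topspace \<tau> - {a}} = U1 - X"
    using ab by (auto simp: F0 topspace_\<tau>)
  ultimately have o2: "openin (power_topology \<tau> n) (U1 - X)" by simp
  show thesis
  proof (cases "U1 \<inter> X = {}")
    case True
    then show ?thesis using that[of U1] U1 by blast
  next
    case False
    then show ?thesis using that[of "U1 \<inter> X"] U1 o1 definable_Int[OF ne U1(2) X] by blast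
  qed
qed

text \<open>By induction on \<open>J\<close>: splitting \<open>U\<close> along \<open>X j\<close>
  gives an open piece inside \<open>X j\<close>, or one disjoint from \<open>X j\<close> and
  therefore covered by the remaining sets.\<close>

lemma definable_cover_interior:
  assumes nice: "nice L M \<tau>" and "finite J"
    and U: "definable L M n U" "openin (power_topology \<tau> n) U" "U \<noteq> {}"
    and "\<And>j. j \<in> J \<Longrightarrow> definable L M n (X j)" "U \<subseteq> (\<Union>j\<in>J. X j)"
  obtains j U0 where "j \<in> J" "U0 \<subseteq> U" "U0 \<subseteq> X j" "definable L M n U0"
    "openin (power_topology \<tau> n) U0" "U0 \<noteq> {}"
proof -
  have "\<exists>j\<in>J. \<exists>U0\<subseteq>U. U0 \<subseteq> X j \<and> definable L M n U0 \<and> openin (power_topology \<tau> n) U0 \<and> U0 \<noteq> {}"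
    using assms(2-)
  proof (induction J arbitrary: U rule: finite_induct)
    case (insert j J)
    from definable_split_interior[OF nice insert.prems(1-3) insert.prems(4)[of j, simplified]]
    obtain U1 where U1: "U1 \<subseteq> U" "definable L M n U1" "openin (power_topology \<tau> n) U1" "U1 \<noteq> {}"
      "U1 \<subseteq> X j \<or> U1 \<inter> X j = {}" .
    show ?case
    proof (cases "U1 \<subseteq> X j")
      case True
      then show ?thesis using U1 by blast
    next
      case False
      then have "U1 \<subseteq> (\<Union>j\<in>J. X j)" using U1(1,5) insert.prems(5) by blast
      then show ?thesis using insert.IH[OF U1(2,3,4)] insert.prems(4) U1(1) by (meson insertCI order_trans)
    qed
  qed auto
  then show thesis using that by blast
qed


section \<open>Definable maps between manifolds\<close>

text \<open>Once one branch of the cell is separated from the others, projection to the base is a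
  homeomorphism near a point of that branch, with the lift to the branch as inverse.\<close>

lemma manifold_local_chart:
  assumes mf: "definable_manifold L M \<tau> m \<sigma>" and "topspace \<sigma> \<noteq> {}"
  obtains i B N \<psi> \<psi>' where "openin (power_topology \<tau> i) B" "definable L M i B" "B \<noteq> {}"
    "openin \<sigma> N" "definable_rel L M m i ((\<lambda>v. (v, \<psi> v)) ` N)"
    "homeomorphic_maps (subtopology \<sigma> N) (subtopology (power_topology \<tau> i) B) \<psi> \<psi>'"
proof -
  let ?P = "power_topology \<tau>"
  from mf obtain \<V> where \<V>: "\<Union>\<V> = topspace \<sigma>" "\<forall>V\<in>\<V>. definable L M m V \<and> openin \<sigma> V \<and>
           (\<exists>p C W h. cell L M \<tau> p C \<and> openin (subtopology (?P p) C) W \<and>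
              homeomorphic_map (subtopology \<sigma> V) (subtopology (?P p) W) h \<and>
              definable_map L M m p V h)"
    unfolding definable_manifold_def by blast
  from \<V>(1) assms(2) obtain V v0 where V: "V \<in> \<V>" "v0 \<in> V" by blast
  from bspec[OF \<V>(2) V(1)] obtain p C W h where
    Vm: "definable L M m V" "openin \<sigma> V" and
    C: "cell L M \<tau> p C" and W: "openin (subtopology (?P p) C) W" and
    h: "homeomorphic_map (subtopology \<sigma> V) (subtopology (?P p) W) h" and
    hdef: "definable_map L M m p V h"
    by (elim conjE exE)
  from C obtain i k U g s where "i \<le> p" and U: "openin (?P i) U" and
    g: "correspondence k U (tuples M (p - i)) g"
    and gcont: "continuous_corr (?P i) (?P (p - i)) k U g" and
    s: "bij_betw s {..<p} {..<p}" and C_eq: "C = coord_proj p s ` corr_graph i (p - i) U g"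
    unfolding cell_def by (elim conjE exE)
  define q where "q = p - i"
  have p: "p = i + q" using \<open>i \<le> p\<close> by (simp add: q_def)
  have VS: "topspace (subtopology \<sigma> V) = V" using openin_subset[OF Vm(2)] by auto
  have WC: "W \<subseteq> C" using W openin_imp_subset by blast
  have WT: "W \<subseteq> tuples M p" using openin_subset[OF W] by simp
  from h obtain h' where hh: "homeomorphic_maps (subtopology \<sigma> V) (subtopology (?P p) W) h h'"
    by (auto simp: homeomorphic_map_maps)
  have WS: "topspace (subtopology (?P p) W) = W" using WT by auto
  have hV: "h v \<in> W" "h' (h v) = v" if "v \<in> V" for v
    using hh that WS VS by (auto simp: homeomorphic_maps_def continuous_map_def)
  have h'W: "h' z \<in> V" "h (h' z) = z" if "z \<in> W" for z
    using hh that WS VS by (auto simp: homeomorphic_maps_def continuous_map_def)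
  define t where "t = inv_into {..<p} s"
  have ts: "t (s j) = j" if "j < p" for j
    using bij_betw_inv_into_left[OF s] that by (simp add: t_def)
  have st: "s (t j) = j" if "j < p" for j
    using bij_betw_inv_into_right[OF s] that by (simp add: t_def)
  have s_less: "s j < p" if "j < p" for j using bij_betwE[OF s] that by auto
  have t_less: "t j < p" if "j < p" for j
    using bij_betwE[OF bij_betw_inv_into[OF s]] that by (auto simp: t_def)
  \<comment> \<open>Since \<open>t\<close> undoes the permutation \<open>s\<close>, these
    projections recover the base point and the fibre point of a point of the cell.\<close>
  define \<pi>1 :: "(nat \<Rightarrow> 'a) \<Rightarrow> nat \<Rightarrow> 'a" where "\<pi>1 = coord_proj i t"
  define \<pi>2 :: "(nat \<Rightarrow> 'a) \<Rightarrow> nat \<Rightarrow> 'a" where "\<pi>2 = coord_proj q (\<lambda>j. t (i + j))"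
  have \<pi>: "\<pi>1 (coord_proj p s (join i q x y)) = x" "\<pi>2 (coord_proj p s (join i q x y)) = y"
    if "x \<in> tuples M i" "y \<in> tuples M q" for x y
    using that p t_less st by (auto simp: \<pi>1_def \<pi>2_def coord_proj_def fun_eq_iff join_def tuples_iff)
  have \<pi>cont: "continuous_map (?P p) (?P i) \<pi>1" "continuous_map (?P p) (?P q) \<pi>2"
    unfolding \<pi>1_def \<pi>2_def using t_less p by (auto intro!: coord_proj_continuous)
  have g_tuples: "y \<in> tuples M q" if "x \<in> U" "y \<in> g x" for x y
    using g that by (auto simp: correspondence_def q_def)
  have U_tuples: "x \<in> tuples M i" if "x \<in> U" for x using openin_subset[OF U] that by auto
  have C_cases: "\<exists>x y. x \<in> U \<and> y \<in> g x \<and> z = coord_proj p s (join i q x y)" if "z \<in> C" for z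
    using that by (auto simp: C_eq corr_graph_def q_def)
  have CI: "coord_proj p s (join i q x y) \<in> C" if "x \<in> U" "y \<in> g x" for x y
    using that by (auto simp: C_eq corr_graph_def q_def)

  have "h v0 \<in> C" using hV(1)[OF V(2)] WC by (rule subsetD[rotated])
  from C_cases[OF this] obtain x0 y0 where
    x0: "x0 \<in> U" "y0 \<in> g x0" "h v0 = coord_proj p s (join i q x0 y0)"
    by (elim exE conjE)
  from gcont[unfolded continuous_corr_def, rule_format, OF x0(1)] obtain U' G where
    U': "openin (subtopology (?P i) U) U'" "x0 \<in> U'" and
    Gc: "\<forall>l<k. continuous_map (subtopology (?P i) U') (?P (p - i)) (G l)" and
    gG: "\<forall>z\<in>U'. g z = (\<lambda>l. G l z) ` {..<k}"
    by (elim exE conjE)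
  have U'U: "U' \<subseteq> U" using U'(1) openin_imp_subset by blast
  have U'_open: "openin (?P i) U'" using U' U openin_trans_full by blast
  have Gc': "continuous_map (subtopology (?P i) U') (?P q) (G l)" if "l < k" for l
    using Gc that by (simp add: q_def)
  have Gg: "G l x \<in> g x" if "l < k" "x \<in> U'" for l x using gG that by auto
  obtain l0 where l0: "l0 < k" "y0 = G l0 x0" using x0(2) gG U'(2) by auto
  \<comment> \<open>Each fibre has exactly \<open>k\<close> elements, so the \<open>k\<close>
    branches take distinct values at \<open>x0\<close> and only \<open>l0\<close> passes through
    \<open>y0\<close>.\<close>
  have "card ((\<lambda>l. G l x0) ` {..<k}) = card {..<k}"
    unfolding bspec[OF gG U'(2), symmetric] using g x0(1) by (simp add: correspondence_def)
  then have "inj_on (\<lambda>l. G l x0) {..<k}" by (intro eq_card_imp_inj_on) auto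
  then have G_ne: "G l x0 \<noteq> y0" if "l < k" "l \<noteq> l0" for l
    using that l0 by (auto dest: inj_onD)
  have "\<exists>A A'. openin (?P q) A \<and> openin (?P q) A' \<and> y0 \<in> A \<and> G l x0 \<in> A' \<and> disjnt A A'"
    if "l < k" "l \<noteq> l0" for l
    using Hausdorff_power[unfolded Hausdorff_space_def, rule_format, of y0 q "G l x0"]
      G_ne[OF that] g_tuples[OF x0(1,2)] g_tuples[OF x0(1) Gg[OF that(1) U'(2)]]
    by auto
  then obtain A A' where A: "\<And>l. l < k \<Longrightarrow> l \<noteq> l0 \<Longrightarrow> openin (?P q) (A l) \<and> openin (?P q) (A' l) \<and>
      y0 \<in> A l \<and> G l x0 \<in> A' l \<and> disjnt (A l) (A' l)"
    by metis
  \<comment> \<open>The factor \<open>tuples M q\<close> keeps \<open>O1\<close> inside the space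
    when \<open>l0\<close> is the only branch and the intersection is over no sets.\<close>
  define O1 where "O1 = tuples M q \<inter> (\<Inter>l\<in>{..<k} - {l0}. A l)"
  have "openin (?P q) O1"
    unfolding O1_def topspace_power[symmetric]
    by (rule openin_Int_Inter) (use A in \<open>auto simp del: topspace_power\<close>)
  moreover have "y0 \<in> O1" using A g_tuples[OF x0(1,2)] by (auto simp: O1_def)
  ultimately obtain Y where Y: "openin (?P q) Y" "definable L M q Y" "y0 \<in> Y" "Y \<subseteq> O1"
    using definable_nbhd by blast

  \<comment> \<open>The lift of a base point to branch \<open>l0\<close>, in the coordinates of the
    cell.\<close>
  define S where "S x = coord_proj p s (join i q x (G l0 x))" for x
  have Scont: "continuous_map (subtopology (?P i) U') (?P p) S"
  proof -
    have "continuous_map (subtopology (?P i) U') (?P (i + q)) (\<lambda>x. join i q x (G l0 x))"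
      using Gc'[OF l0(1)] by (intro join_continuous) (auto simp: continuous_map_from_subtopology)
    from continuous_map_compose[OF this[folded p] coord_proj_continuous[of p s p]] s_less
    show ?thesis by (simp add: S_def[abs_def] o_def)
  qed
  have SC: "S x \<in> C" if "x \<in> U'" for x
    unfolding S_def using that U'U by (intro CI Gg l0(1)) auto
  obtain W' where W': "openin (?P p) W'" "W = W' \<inter> C"
    using W by (auto simp: openin_subtopology)
  \<comment> \<open>Base points whose lift lies in the chart image, whose branch \<open>l0\<close>
    stays in \<open>Y\<close>, and whose other branches stay in the sets \<open>A' l\<close>, hence
    outside \<open>Y\<close>.\<close>
  define K where "K = {x \<in> U'. S x \<in> W'} \<inter> {x \<in> U'. G l0 x \<in> Y} \<inter>
     (U' \<inter> (\<Inter>l\<in>{..<k} - {l0}. {x \<in> U'. G l x \<in> A' l}))"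
  have "openin (?P i) (U' \<inter> (\<Inter>l\<in>{..<k} - {l0}. {x \<in> U'. G l x \<in> A' l}))"
    by (rule openin_Int_Inter)
      (use U'_open A Gc' in \<open>auto intro!: continuous_map_preimage_open[OF _ U'_open]\<close>)
  then have "openin (?P i) K"
    unfolding K_def
    by (rule openin_Int[OF openin_Int[OF continuous_map_preimage_open[OF Scont U'_open W'(1)]
        continuous_map_preimage_open[OF Gc'[OF l0(1)] U'_open Y(1)]]])
  moreover have "S x0 = h v0" by (simp add: S_def x0(3) l0(2))
  then have "x0 \<in> K" using U'(2) hV(1)[OF V(2)] W'(2) Y(3) l0(2) A by (auto simp: K_def)
  ultimately obtain B where B: "openin (?P i) B" "definable L M i B" "x0 \<in> B" "B \<subseteq> K"
    using definable_nbhd by blast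
  have BK: "x \<in> U'" "x \<in> U" "x \<in> tuples M i" "S x \<in> W" "G l0 x \<in> Y" if "x \<in> B" for x
    using that B(4) U'U U_tuples SC W'(2) by (auto simp: K_def)
  have unique: "y = G l0 x" if x: "x \<in> B" and y: "y \<in> g x" "y \<in> Y" for x y
  proof (rule ccontr)
    assume "y \<noteq> G l0 x"
    then obtain l where l: "l < k" "l \<noteq> l0" "y = G l x" using gG BK(1)[OF x] y(1) by auto
    have "y \<in> A' l" "y \<in> A l" using l x y(2) B(4) Y(4) by (auto simp: K_def O1_def)
    then show False using A[OF l(1,2)] by (auto simp: disjnt_def)
  qed

  \<comment> \<open>Cut out by definable open conditions on base and fibre point; by
    \<open>unique\<close>, only branch \<open>l0\<close> meets them.\<close>
  define N where "N = {v \<in> V. h v \<in> {z \<in> tuples M p. \<pi>1 z \<in> B} \<inter> {z \<in> tuples M p. \<pi>2 z \<in> Y}}"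
  define \<psi> where "\<psi> v = \<pi>1 (h v)" for v
  define \<psi>' where "\<psi>' x = h' (S x)" for x
  have hcont: "continuous_map (subtopology \<sigma> V) (?P p) h"
    using hh by (auto simp: homeomorphic_maps_def continuous_map_in_subtopology)
  have "openin (?P p) {z \<in> tuples M p. \<pi>1 z \<in> B}" "openin (?P p) {z \<in> tuples M p. \<pi>2 z \<in> Y}"
    using openin_continuous_map_preimage[OF \<pi>cont(1) B(1)]
      openin_continuous_map_preimage[OF \<pi>cont(2) Y(1)] by simp_all
  then have N: "openin \<sigma> N"
    unfolding N_def by (intro continuous_map_preimage_open[OF hcont Vm(2)] openin_Int)
  have NS: "topspace (subtopology \<sigma> N) = N" using openin_subset[OF N] by auto
  have BS: "topspace (subtopology (?P i) B) = B" using openin_subset[OF B(1)] by auto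
  have NV: "v \<in> V" "\<psi> v \<in> B" if "v \<in> N" for v using that by (auto simp: N_def \<psi>_def)
  have S\<psi>: "S (\<psi> v) = h v" if v: "v \<in> N" for v
  proof -
    have "h v \<in> C" using hV(1)[OF NV(1)[OF v]] WC by (rule subsetD[rotated])
    from C_cases[OF this] obtain x y where
      xy: "x \<in> U" "y \<in> g x" "h v = coord_proj p s (join i q x y)"
      by (elim exE conjE)
    have "\<psi> v = x" "\<pi>2 (h v) = y"
      unfolding \<psi>_def xy(3) using \<pi> U_tuples[OF xy(1)] g_tuples[OF xy(1,2)] by auto
    moreover from this have "y = G l0 x"
      using NV(2)[OF v] v xy(2) by (intro unique) (auto simp: N_def)
    ultimately show ?thesis by (simp add: S_def xy(3))
  qed
  have \<psi>S: "\<pi>1 (S x) = x" "\<pi>2 (S x) = G l0 x" if "x \<in> B" for x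
    unfolding S_def using \<pi> BK[OF that] g_tuples Gg[OF l0(1)] by blast+
  have \<psi>'N: "\<psi>' x \<in> N" "\<psi> (\<psi>' x) = x" if x: "x \<in> B" for x
    using h'W[OF BK(4)[OF x]] \<psi>S[OF x] BK[OF x] WT x by (auto simp: N_def \<psi>_def \<psi>'_def)
  have "homeomorphic_maps (subtopology \<sigma> N) (subtopology (?P i) B) \<psi> \<psi>'"
    unfolding homeomorphic_maps_def
  proof (intro conjI)
    have "continuous_map (subtopology \<sigma> N) (?P p) h"
      using hcont NV(1) by (intro continuous_map_from_subtopology_mono[OF hcont]) auto
    from continuous_map_compose[OF this \<pi>cont(1)]
    show "continuous_map (subtopology \<sigma> N) (subtopology (?P i) B) \<psi>"
      using NV(2) by (auto simp: continuous_map_in_subtopology \<psi>_def[abs_def] o_def)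
    have "continuous_map (subtopology (?P i) B) (?P p) S"
      using BK(1) by (intro continuous_map_from_subtopology_mono[OF Scont]) auto
    then have "continuous_map (subtopology (?P i) B) (subtopology (?P p) W) S"
      using BK(4) by (auto simp: continuous_map_in_subtopology)
    moreover have "continuous_map (subtopology (?P p) W) \<sigma> h'"
      using hh by (auto simp: homeomorphic_maps_def continuous_map_in_subtopology)
    ultimately have "continuous_map (subtopology (?P i) B) \<sigma> (h' \<circ> S)"
      by (rule continuous_map_compose)
    then show "continuous_map (subtopology (?P i) B) (subtopology \<sigma> N) \<psi>'"
      using \<psi>'N(1) by (auto simp: continuous_map_in_subtopology \<psi>'_def[abs_def] o_def)
    show "\<forall>v\<in>topspace (subtopology \<sigma> N). \<psi>' (\<psi> v) = v"
      unfolding NS \<psi>'_def using S\<psi> hV(2) NV(1) by simp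
    show "\<forall>x\<in>topspace (subtopology (?P i) B). \<psi> (\<psi>' x) = x"
      unfolding BS using \<psi>'N(2) by simp
  qed
  moreover have "definable_rel L M m i ((\<lambda>v. (v, \<psi> v)) ` N)"
  proof -
    \<comment> \<open>The graph of \<open>\<pi>1\<close> over \<open>B\<close> and \<open>Y\<close>,
      both definable; composing the graph of \<open>h\<close> with it gives the graph of
      \<open>\<psi>\<close> on \<open>N\<close>.\<close>
    define E where "E = (\<lambda>z. (z, \<pi>1 z)) ` {z \<in> tuples M p. \<pi>1 z \<in> B \<and> \<pi>2 z \<in> Y}"
    have "definable_rel L M p i E"
    proof (rule definable_relI[OF ne])
      show "E \<subseteq> tuples M p \<times> tuples M i" using BK(3) by (auto simp: E_def)
      show "dpred L M (\<lambda>e. (\<forall>j<i. e (p + j) = e (t j)) \<and>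
          (\<lambda>j\<in>{..<i}. e (t j)) \<in> B \<and> (\<lambda>j\<in>{..<q}. e (t (i + j))) \<in> Y)"
        by (intro dpred_conj dpred_all_less[OF ne] dpred_eq[OF ne])
          (rule dpred_definable[OF ne B(2)] dpred_definable[OF ne Y(2)])+
      fix e :: "nat \<Rightarrow> 'a" assume e: "range e \<subseteq> univ M"
      have "\<pi>1 (\<lambda>j\<in>{..<p}. e j) = (\<lambda>j\<in>{..<i}. e (t j))"
        "\<pi>2 (\<lambda>j\<in>{..<p}. e j) = (\<lambda>j\<in>{..<q}. e (t (i + j)))"
        using t_less p by (auto simp: \<pi>1_def \<pi>2_def coord_proj_def fun_eq_iff)
      moreover have "(\<lambda>j\<in>{..<i}. e (p + j)) = (\<lambda>j\<in>{..<i}. e (t j)) \<longleftrightarrow> (\<forall>j<i. e (p + j) = e (t j))"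
        by (auto simp: fun_eq_iff)
      moreover have "(\<lambda>j\<in>{..<p}. e j) \<in> tuples M p"
        using restrict_in_tuples[OF e, where s = "\<lambda>j. j"] .
      ultimately show "((\<lambda>j\<in>{..<p}. e j), (\<lambda>j\<in>{..<i}. e (p + j))) \<in> E \<longleftrightarrow>
          (\<forall>j<i. e (p + j) = e (t j)) \<and>
          (\<lambda>j\<in>{..<i}. e (t j)) \<in> B \<and> (\<lambda>j\<in>{..<q}. e (t (i + j))) \<in> Y"
        unfolding E_def by (auto simp: image_iff)
    qed
    moreover have "definable_rel L M m p ((\<lambda>v. (v, h v)) ` V)"
      using hdef definable_map_rel[of h V M p m L] hV(1) WT definable_subset[OF Vm(1)] by auto
    moreover have "(\<lambda>v. (v, h v)) ` V O E = (\<lambda>v. (v, \<psi> v)) ` N"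
      using hV(1) WT by (auto simp: E_def N_def \<psi>_def relcomp_unfold image_iff)
    ultimately show ?thesis using definable_rel_comp[OF ne] by metis
  qed
  ultimately show thesis using that[of i B N \<psi> \<psi>'] B N by blast
qed

text \<open>Read through a chart of the source and one of the target, \<open>f\<close> becomes a
  function between powers of the universe, where generic continuity is available; the resulting open
  set is pulled back to the source.\<close>

lemma definable_map_continuous_somewhere:
  assumes nice: "nice L M \<tau>"
    and X: "definable_manifold L M \<tau> m \<sigma>" "topspace \<sigma> \<noteq> {}"
    and Y: "definable_manifold L M \<tau> n \<rho>"
    and f: "definable_map L M m n (topspace \<sigma>) f" "f ` topspace \<sigma> \<subseteq> topspace \<rho>"
  obtains N where "openin \<sigma> N" "N \<noteq> {}" "continuous_map (subtopology \<sigma> N) \<rho> f"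
proof -
  let ?P = "power_topology \<tau>"
  obtain i B N \<psi> \<psi>' where B: "openin (?P i) B" "definable L M i B" "B \<noteq> {}"
    and N: "openin \<sigma> N" and \<psi>def: "definable_rel L M m i ((\<lambda>v. (v, \<psi> v)) ` N)"
    and \<psi>: "homeomorphic_maps (subtopology \<sigma> N) (subtopology (?P i) B) \<psi> \<psi>'"
    by (rule manifold_local_chart[OF X])
  have NX: "N \<subseteq> topspace \<sigma>" using openin_subset[OF N] .
  have BT: "B \<subseteq> tuples M i" using openin_subset[OF B(1)] by simp
  have \<psi>N: "\<psi> v \<in> B" "\<psi>' (\<psi> v) = v" if "v \<in> N" for v
    using \<psi> that NX BT by (auto simp: homeomorphic_maps_def continuous_map_def)
  have \<psi>'B: "\<psi>' x \<in> N" "\<psi> (\<psi>' x) = x" if "x \<in> B" for x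
    using \<psi> that NX BT by (auto simp: homeomorphic_maps_def continuous_map_def)
  have XT: "topspace \<sigma> \<subseteq> tuples M m"
    by (rule definable_subset[OF conjunct1[OF X(1)[unfolded definable_manifold_def]]])
  have YT: "topspace \<rho> \<subseteq> tuples M n"
    by (rule definable_subset[OF conjunct1[OF Y[unfolded definable_manifold_def]]])
  have frel: "definable_rel L M m n ((\<lambda>v. (v, f v)) ` topspace \<sigma>)"
    using f(1) definable_map_rel[of f "topspace \<sigma>" M n m L] f(2) XT YT by blast
  from Y obtain \<V> where \<V>: "finite \<V>" "\<Union>\<V> = topspace \<rho>" "\<forall>V\<in>\<V>. definable L M n V \<and> openin \<rho> V \<and>
           (\<exists>p C W h. cell L M \<tau> p C \<and> openin (subtopology (?P p) C) W \<and>
              homeomorphic_map (subtopology \<rho> V) (subtopology (?P p) W) h \<and>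
              definable_map L M n p V h)"
    unfolding definable_manifold_def by blast
  \<comment> \<open>The graph of \<open>f\<close> after \<open>\<psi>'\<close>: the converse of the
    graph of \<open>\<psi>\<close> supplies \<open>\<psi>'\<close> in definable form.\<close>
  define R where "R = ((\<lambda>v. (v, \<psi> v)) ` N)\<inverse> O (\<lambda>v. (v, f v)) ` topspace \<sigma>"
  have Rdef: "definable_rel L M i n R"
    unfolding R_def by (intro definable_rel_comp[OF ne _ frel] definable_rel_converse[OF ne \<psi>def])
  have R_eq: "R = (\<lambda>x. (x, f (\<psi>' x))) ` B"
    unfolding R_def using \<psi>N \<psi>'B NX by (force simp: relcomp_unfold image_iff)
  define D where "D V = {x \<in> B. f (\<psi>' x) \<in> V}" for V
  have D: "definable L M i (D V)" if "definable L M n V" for V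
  proof -
    \<comment> \<open>Restriction acts on first components, so the converse of \<open>R\<close> is
      restricted to \<open>V\<close> and then turned back.\<close>
    have "definable_rel L M n i {(y, x) \<in> R\<inverse>. y \<in> V}"
      by (rule definable_rel_restrict[OF ne definable_rel_converse[OF ne Rdef] that])
    from definable_Domain[OF ne definable_rel_converse[OF ne this]]
    have "definable L M i (Domain ({(y, x) \<in> R\<inverse>. y \<in> V}\<inverse>))" .
    moreover have "Domain ({(y, x) \<in> R\<inverse>. y \<in> V}\<inverse>) = D V"
      by (auto simp: R_eq D_def)
    ultimately show ?thesis by simp
  qed
  have "B \<subseteq> (\<Union>V\<in>\<V>. D V)"
    using \<V>(2) f(2) \<psi>'B(1) NX by (fastforce simp: D_def)
  then obtain V U where V: "V \<in> \<V>" and U: "U \<subseteq> B" "U \<subseteq> D V" "definable L M i U" "openin (?P i) U" "U \<noteq> {}"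
    using definable_cover_interior[OF nice \<V>(1) B(2,1,3), of D] D \<V>(3) by metis
  from bspec[OF \<V>(3) V] obtain p C W h where Vn: "definable L M n V" "openin \<rho> V"
    and W: "openin (subtopology (?P p) C) W"
    and h: "homeomorphic_map (subtopology \<rho> V) (subtopology (?P p) W) h"
    and hdef: "definable_map L M n p V h"
    by (elim conjE exE)
  from h obtain h' where hh: "homeomorphic_maps (subtopology \<rho> V) (subtopology (?P p) W) h h'"
    by (auto simp: homeomorphic_map_maps)
  have VT: "V \<subseteq> topspace \<rho>" using openin_subset[OF Vn(2)] .
  have WT: "W \<subseteq> tuples M p" using openin_subset[OF W] by simp
  have hV: "h v \<in> W" "h' (h v) = v" if "v \<in> V" for v
    using hh that VT WT by (auto simp: homeomorphic_maps_def continuous_map_def)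
  have hrel: "definable_rel L M n p ((\<lambda>v. (v, h v)) ` V)"
    using hdef definable_map_rel[of h V M p n L] hV(1) WT definable_subset[OF Vn(1)] by blast
  define F where "F x = h (f (\<psi>' x))" for x
  have "{(x, y) \<in> R O (\<lambda>v. (v, h v)) ` V. x \<in> U} = (\<lambda>x. (x, F x)) ` U"
    unfolding R_eq F_def using U(1,2) by (fastforce simp: relcomp_unfold image_iff D_def)
  then have "definable_rel L M i p ((\<lambda>x. (x, F x)) ` U)"
    using definable_rel_restrict[OF ne definable_rel_comp[OF ne Rdef hrel] U(3)] by simp
  from definable_function_continuous[OF nice U(3-5) this] obtain U0 where
    U0: "U0 \<subseteq> U" "openin (?P i) U0" "U0 \<noteq> {}"
    and Fcont: "continuous_map (subtopology (?P i) U0) (?P p) F" by metis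
  define N0 where "N0 = {v \<in> N. \<psi> v \<in> U0}"
  have \<psi>cont: "continuous_map (subtopology \<sigma> N) (?P i) \<psi>"
    using \<psi> by (auto simp: homeomorphic_maps_def continuous_map_in_subtopology)
  show thesis
  proof
    show "openin \<sigma> N0"
      unfolding N0_def by (rule continuous_map_preimage_open[OF \<psi>cont N U0(2)])
    show "N0 \<noteq> {}" using U0(1,3) U(1) \<psi>'B by (fastforce simp: N0_def)
    have "continuous_map (subtopology \<sigma> N0) (?P i) \<psi>"
      by (rule continuous_map_from_subtopology_mono[OF \<psi>cont]) (auto simp: N0_def)
    then have "continuous_map (subtopology \<sigma> N0) (subtopology (?P i) U0) \<psi>"
      by (auto simp: continuous_map_in_subtopology N0_def)
    from continuous_map_compose[OF this Fcont]
    have "continuous_map (subtopology \<sigma> N0) (?P p) (F \<circ> \<psi>)" .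
    moreover have fV: "f v \<in> V" "(F \<circ> \<psi>) v = h (f v)" if "v \<in> N0" for v
      using that U0(1) U(2) \<psi>N by (auto simp: N0_def D_def F_def)
    ultimately have "continuous_map (subtopology \<sigma> N0) (subtopology (?P p) W) (F \<circ> \<psi>)"
      using hV(1) by (auto simp: continuous_map_in_subtopology)
    moreover have "continuous_map (subtopology (?P p) W) \<rho> h'"
      using hh by (auto simp: homeomorphic_maps_def continuous_map_in_subtopology)
    ultimately have "continuous_map (subtopology \<sigma> N0) \<rho> (h' \<circ> (F \<circ> \<psi>))"
      by (rule continuous_map_compose)
    \<comment> \<open>Undoing the target chart, \<open>f\<close> is \<open>h'\<close> after
      \<open>F\<close> after \<open>\<psi>\<close> on \<open>N0\<close>.\<close>
    then show "continuous_map (subtopology \<sigma> N0) \<rho> f"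
      by (rule continuous_map_eq) (use fV hV(2) in auto)
  qed
qed

end


section \<open>Homomorphisms\<close>

text \<open>Left translation by a suitable \<open>c\<close> moves a given \<open>x\<close> into
  \<open>N\<close>; near \<open>x\<close> the map \<open>f\<close> is that translation, then
  \<open>f\<close> on \<open>N\<close>, then left translation by the inverse of
  \<open>f c\<close>.\<close>

lemma topological_group_hom_continuous:
  assumes G: "is_topological_group G \<sigma>" and H: "is_topological_group H \<rho>"
    and f: "f \<in> hom G H" and N: "openin \<sigma> N" "N \<noteq> {}"
    and cont: "continuous_map (subtopology \<sigma> N) \<rho> f"
  shows "continuous_map \<sigma> \<rho> f"
proof -
  interpret G: group G using G by (simp add: is_topological_group_def)
  interpret H: group H using H by (simp add: is_topological_group_def)
  have tG: "topspace \<sigma> = carrier G" and tH: "topspace \<rho> = carrier H"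
    using G H by (auto simp: is_topological_group_def)
  have transG: "continuous_map \<sigma> \<sigma> (\<lambda>y. c \<otimes>\<^bsub>G\<^esub> y)" if "c \<in> carrier G" for c
  proof -
    have "continuous_map \<sigma> (prod_topology \<sigma> \<sigma>) (\<lambda>y. (c, y))"
      using that tG by (simp add: continuous_map_pairwise o_def)
    from continuous_map_compose[OF this, of \<sigma> "\<lambda>(x, y). x \<otimes>\<^bsub>G\<^esub> y"] G show ?thesis
      by (simp add: is_topological_group_def o_def)
  qed
  have transH: "continuous_map \<rho> \<rho> (\<lambda>y. c \<otimes>\<^bsub>H\<^esub> y)" if "c \<in> carrier H" for c
  proof -
    have "continuous_map \<rho> (prod_topology \<rho> \<rho>) (\<lambda>y. (c, y))"
      using that tH by (simp add: continuous_map_pairwise o_def)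
    from continuous_map_compose[OF this, of \<rho> "\<lambda>(x, y). x \<otimes>\<^bsub>H\<^esub> y"] H show ?thesis
      by (simp add: is_topological_group_def o_def)
  qed
  have local: "\<exists>N. openin \<sigma> N \<and> x \<in> N \<and> continuous_map (subtopology \<sigma> N) \<rho> f"
    if "x \<in> topspace \<sigma>" for x
  proof -
    have x: "x \<in> carrier G" using that by (simp add: tG)
    obtain a where a: "a \<in> N" using N(2) by blast
    have NG: "N \<subseteq> carrier G" using openin_subset[OF N(1)] tG by simp
    define c where "c = a \<otimes>\<^bsub>G\<^esub> inv\<^bsub>G\<^esub> x"
    have c: "c \<in> carrier G" "c \<otimes>\<^bsub>G\<^esub> x = a" using a NG x by (auto simp: c_def G.m_assoc)
    have fG: "f y \<in> carrier H" if "y \<in> carrier G" for y using f that by (auto simp: hom_def)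
    let ?N = "{y \<in> topspace \<sigma>. c \<otimes>\<^bsub>G\<^esub> y \<in> N}"
    have "openin \<sigma> ?N" using transG[OF c(1)] N(1) by (rule openin_continuous_map_preimage)
    moreover have "x \<in> ?N" using c a x tG by simp
    moreover have "continuous_map (subtopology \<sigma> ?N) \<rho> f"
    proof -
      have "continuous_map (subtopology \<sigma> ?N) (subtopology \<sigma> N) (\<lambda>y. c \<otimes>\<^bsub>G\<^esub> y)"
        using continuous_map_from_subtopology[OF transG[OF c(1)], of ?N]
        by (auto simp: continuous_map_in_subtopology)
      from continuous_map_compose[OF continuous_map_compose[OF this cont] transH[of "inv\<^bsub>H\<^esub> f c"]]
      have "continuous_map (subtopology \<sigma> ?N) \<rho> (\<lambda>y. inv\<^bsub>H\<^esub> f c \<otimes>\<^bsub>H\<^esub> f (c \<otimes>\<^bsub>G\<^esub> y))"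
        using fG[OF c(1)] by (simp add: o_def)
      then show ?thesis
      proof (rule continuous_map_eq)
        fix y assume "y \<in> topspace (subtopology \<sigma> ?N)"
        then have y: "y \<in> carrier G" by (simp add: tG)
        have "f (c \<otimes>\<^bsub>G\<^esub> y) = f c \<otimes>\<^bsub>H\<^esub> f y" using hom_mult[OF f c(1) y] .
        then show "inv\<^bsub>H\<^esub> f c \<otimes>\<^bsub>H\<^esub> f (c \<otimes>\<^bsub>G\<^esub> y) = f y"
          using fG[OF c(1)] fG[OF y] by (simp add: H.m_assoc[symmetric])
      qed
    qed
    ultimately show ?thesis by blast
  qed
  show ?thesis
    \<comment> \<open>The pieces are all open sets on which \<open>f\<close> is continuous; by
      \<open>local\<close> they cover the space.\<close>
    by (rule pasting_lemma[where I = "{N. openin \<sigma> N \<and> continuous_map (subtopology \<sigma> N) \<rho> f}"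
          and T = "\<lambda>N. N" and f = "\<lambda>_. f"]) (use local in blast)+
qed

theorem theorem7p13:
  fixes L :: "('f, 'r) fo_lang" and T :: "('f, 'r) fm set"
    and M :: "('f, 'r, 'a) fo_struct" and \<tau> :: "'a topology"
    and m n :: nat and G H :: "(nat \<Rightarrow> 'a) monoid"
    and \<sigma>\<^sub>G \<sigma>\<^sub>H :: "(nat \<Rightarrow> 'a) topology"
    and f :: "(nat \<Rightarrow> 'a) \<Rightarrow> (nat \<Rightarrow> 'a)"
  assumes "t_minimal TYPE('a) L T"
    and "monster_model L T M"
    and "t_minimal_topology L M \<tau>"
    and "nice L M \<tau>"
    and "definable_group L M m G"
    and "definable_group L M n H"
    and "canonical_topology L M \<tau> m G \<sigma>\<^sub>G"
    and "canonical_topology L M \<tau> n H \<sigma>\<^sub>H"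
    and "f \<in> hom G H"
    and "definable_map L M m n (carrier G) f"
  shows "continuous_map \<sigma>\<^sub>G \<sigma>\<^sub>H f"
proof -
  have "univ M \<noteq> {}"
    using assms(2) by (simp add: monster_model_def is_model_def fo_structure_def)
  then interpret t_minimal_structure L M \<tau>
    using assms(3) by unfold_locales
  have G: "definable_manifold L M \<tau> m \<sigma>\<^sub>G" "is_topological_group G \<sigma>\<^sub>G"
    and H: "definable_manifold L M \<tau> n \<sigma>\<^sub>H" "is_topological_group H \<sigma>\<^sub>H"
    using assms(7,8) by (auto simp: canonical_topology_def)
  have top: "topspace \<sigma>\<^sub>G = carrier G" "topspace \<sigma>\<^sub>H = carrier H"
    using G(2) H(2) by (auto simp: is_topological_group_def)
  have "group G" using G(2) by (simp add: is_topological_group_def)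
  \<comment> \<open>The unit of \<open>G\<close> provides a point at which to take a chart.\<close>
  then have "topspace \<sigma>\<^sub>G \<noteq> {}"
    unfolding top using monoid.one_closed[OF group.is_monoid] by blast
  moreover have "definable_map L M m n (topspace \<sigma>\<^sub>G) f" "f ` topspace \<sigma>\<^sub>G \<subseteq> topspace \<sigma>\<^sub>H"
    using assms(9,10) by (auto simp: top hom_def)
  ultimately obtain N where "openin \<sigma>\<^sub>G N" "N \<noteq> {}" "continuous_map (subtopology \<sigma>\<^sub>G N) \<sigma>\<^sub>H f"
    using definable_map_continuous_somewhere[OF assms(4) G(1) _ H(1)] by metis
  then show ?thesis
    by (rule topological_group_hom_continuous[OF G(2) H(2) assms(9)])
qed

end
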